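(* Let $|\psi_1\rangle,|\psi_2\rangle$ be unknown pure states of the same dimension, and suppose it is promised that $\Delta:=\arccos|\langle\psi_1|\psi_2\rangle|$ is known and $\Delta\notin\{0,\pi/2\}$. Let $e^{i\varphi}:=\langle\psi_2|\psi_1\rangle/|\langle\psi_2|\psi_1\rangle|$ and, for $\chi\in\mathbb{R}$, $$|\psi(\chi)\rangle:=\frac{1}{\sin\Delta}\Big(\sin(\Delta-\chi)|\psi_1\rangle+e^{i\varphi}\sin\chi\,|\psi_2\rangle\Big).$$ Then a state within trace distance $\delta$ of $|\psi(\chi)\rangle\langle\psi(\chi)|$ can be produced using $O\!\left(\frac{\chi^2}{\delta\sin^2 2\Delta}\right)$ copies of $|\psi_1\rangle$ and of $|\psi_2\rangle$.
   Context: The trace distance between states $\rho,\sigma$ is $\tfrac12\|\rho-\sigma\|_1$ with $\|A\|_1=\operatorname{Tr}\sqrt{AA^\dagger}$.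
   Formalization: The number of copies is bounded by a universal constant times max(1, χ²/(δ sin² 2Δ)); the bare expression would allow zero copies at χ = 0, where at least one copy of the first state is needed. *)

theory Defs
  imports Complex_Main "Jordan_Normal_Form.Matrix"
begin

text \<open>Finite-dimensional quantum states, represented with the explicit-dimension
matrices of Jordan_Normal_Form (dimension stored in the value, so that
tensor powers of varying size can be formed).\<close>

definition cinner :: "complex vec \<Rightarrow> complex vec \<Rightarrow> complex" where
  "cinner u v = (\<Sum>i<dim_vec v. cnj (u $ i) * v $ i)"

definition unit_state :: "nat \<Rightarrow> complex vec \<Rightarrow> bool" where
  "unit_state d v \<longleftrightarrow> v \<in> carrier_vec d \<and> cinner v v = 1"

definition dagger :: "complex mat \<Rightarrow> complex mat" where
  "dagger A = mat (dim_col A) (dim_row A) (\<lambda>(i,j). cnj (A $$ (j,i)))"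

definition mtrace :: "complex mat \<Rightarrow> complex" where
  "mtrace A = (\<Sum>i<dim_row A. A $$ (i,i))"

definition psd :: "nat \<Rightarrow> complex mat \<Rightarrow> bool" where
  "psd n B \<longleftrightarrow> B \<in> carrier_mat n n \<and> dagger B = B \<and>
     (\<forall>v\<in>carrier_vec n. 0 \<le> Re (cinner v (B *\<^sub>v v)))"

definition psd_sqrt :: "complex mat \<Rightarrow> complex mat" where
  "psd_sqrt P = (THE B. psd (dim_row P) B \<and> B * B = P)"

definition trace_norm :: "complex mat \<Rightarrow> real" where
  "trace_norm A = Re (mtrace (psd_sqrt (A * dagger A)))"

definition trace_dist :: "complex mat \<Rightarrow> complex mat \<Rightarrow> real" where
  "trace_dist \<rho> \<sigma> = trace_norm (\<rho> - \<sigma>) / 2"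

definition proj :: "complex vec \<Rightarrow> complex mat" where
  "proj v = mat (dim_vec v) (dim_vec v) (\<lambda>(i,j). v $ i * cnj (v $ j))"

definition kron_vec :: "complex vec \<Rightarrow> complex vec \<Rightarrow> complex vec" where
  "kron_vec u v = vec (dim_vec u * dim_vec v)
     (\<lambda>k. u $ (k div dim_vec v) * v $ (k mod dim_vec v))"

fun tpow :: "nat \<Rightarrow> complex vec \<Rightarrow> complex vec" where
  "tpow 0 v = vec 1 (\<lambda>_. 1)"
| "tpow (Suc m) v = kron_vec v (tpow m v)"

definition kraus_channel :: "nat \<Rightarrow> nat \<Rightarrow> complex mat list \<Rightarrow> bool" where
  "kraus_channel D d Ks \<longleftrightarrow> (\<forall>K\<in>set Ks. K \<in> carrier_mat d D) \<and>
     foldr (\<lambda>K S. dagger K * K + S) Ks (0\<^sub>m D D) = 1\<^sub>m D"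

definition apply_channel :: "nat \<Rightarrow> nat \<Rightarrow> complex mat list \<Rightarrow> complex mat \<Rightarrow> complex mat" where
  "apply_channel D d Ks \<rho> = foldr (\<lambda>K S. K * \<rho> * dagger K + S) Ks (0\<^sub>m d d)"

definition psi_chi :: "complex vec \<Rightarrow> complex vec \<Rightarrow> real \<Rightarrow> real \<Rightarrow> complex vec" where
  "psi_chi \<psi>1 \<psi>2 \<Delta> \<chi> =
     (let e = cinner \<psi>2 \<psi>1 / complex_of_real (cmod (cinner \<psi>2 \<psi>1)) in
      (complex_of_real (1 / sin \<Delta>)) \<cdot>\<^sub>v
        (complex_of_real (sin (\<Delta> - \<chi>)) \<cdot>\<^sub>v \<psi>1 + (e * complex_of_real (sin \<chi>)) \<cdot>\<^sub>v \<psi>2))"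

end

theory Submission
  imports Defs
begin

text \<open>
  Choose the phase of the second state so that the overlap is cos \<Delta>, and let e complete the
  first state u to an orthonormal basis of the plane spanned by both. The commutator of the two
  projectors is then sin (2 \<Delta>) / 2 times the generator of rotations of this plane.

  Let P be the cyclic permutation of three registers holding \<sigma>, \<psi>1, \<psi>2. Applying the channel with
  Kraus operators \<alpha> + \<beta> P and \<alpha> - \<beta> P*, where \<alpha>^2 + \<beta>^2 = 1/2, and discarding the last two
  registers maps \<sigma> to 2 \<alpha>^2 \<sigma> + \<beta>^2 (\<rho>1 + \<rho>2) + \<alpha> \<beta> [\<sigma>, [\<rho>1, \<rho>2]]: a rotation by an angle of order
  \<beta> sin (2 \<Delta>), up to an error of order \<beta>^2, at the price of one copy of each state.

  Real density matrices of the plane are described by a Bloch vector, viewed as a complex number z,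
  and the trace distance of two of them is |z - z'| / 2. The step is the affine map
  z \<mapsto> (2 \<alpha>^2 + i \<alpha> \<beta> sin (2 \<Delta>)) z + \<beta>^2 (1 + exp (2 i \<Delta>)), whose linear part is a contraction, so the
  errors of n steps with \<beta> of order \<chi> / (n sin (2 \<Delta>)) add up to O(\<chi>^2 / (n sin(2 \<Delta>)^2)).
\<close>

section \<open>Adjoints and outer products\<close>

text \<open>The states are unknown, so the channel is fixed before they are and may depend only on
  \<open>d\<close>, \<open>\<Delta>\<close>, \<open>\<chi>\<close> and \<open>\<delta>\<close>. The
  phase of the second state and the vector e occur in the analysis alone, which is sound because
  copies enter as projectors. The method is density matrix exponentiation with a three-cycle in
  place of a swap: a swap yields the commutator with a single state, whereas tracing P minus its
  adjoint against \<rho>1 and \<rho>2 yields their commutator, which is already anti-Hermitian and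
  has real entries in the adapted frame. A short unitary evolution would leave terms of higher order
  in the step; the Kraus pair is of degree two in \<alpha> and \<beta>, so one step is an exact
  affine map and every estimate concerns complex numbers. The other obstacle is that
  \<open>psd_sqrt\<close> is a definite description: a trace distance can be evaluated only after
  uniqueness of the root. This is proved just for multiples of projections, which suffices because
  all iterates stay in the Bloch plane, where the distance has a closed form; general properties of
  the trace norm never enter.\<close>

definition outer :: "complex vec \<Rightarrow> complex vec \<Rightarrow> complex mat" where
  "outer u v = mat (dim_vec u) (dim_vec v) (\<lambda>(i,j). u $ i * cnj (v $ j))"

lemma outer_carrier [simp]:
  "u \<in> carrier_vec n \<Longrightarrow> v \<in> carrier_vec m \<Longrightarrow> outer u v \<in> carrier_mat n m"
  by (auto simp: outer_def)

lemma proj_eq_outer: "proj v = outer v v"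
  by (simp add: proj_def outer_def)

lemma dagger_carrier [simp]: "A \<in> carrier_mat n m \<Longrightarrow> dagger A \<in> carrier_mat m n"
  by (auto simp: dagger_def)

lemma dagger_dim [simp]: "dim_row (dagger A) = dim_col A" "dim_col (dagger A) = dim_row A"
  by (auto simp: dagger_def)

lemma dagger_index [simp]:
  "i < dim_col A \<Longrightarrow> j < dim_row A \<Longrightarrow> dagger A $$ (i, j) = cnj (A $$ (j, i))"
  by (simp add: dagger_def)

lemma dagger_dagger [simp]: "dagger (dagger A) = A"
  by (rule eq_matI) auto

lemma dagger_one [simp]: "dagger (1\<^sub>m n) = 1\<^sub>m n"
  by (rule eq_matI) auto

lemma dagger_smult: "dagger (c \<cdot>\<^sub>m A) = cnj c \<cdot>\<^sub>m dagger A"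
  by (rule eq_matI) auto

lemma dagger_add:
  assumes "A \<in> carrier_mat n m" "B \<in> carrier_mat n m"
  shows "dagger (A + B) = dagger A + dagger B"
  using assms by (intro eq_matI) auto

lemma mat_mult_index:
  assumes "A \<in> carrier_mat n m" "B \<in> carrier_mat m l" "i < n" "j < l"
  shows "(A * B) $$ (i, j) = (\<Sum>k<m. A $$ (i, k) * B $$ (k, j))"
  using assms by (auto simp: scalar_prod_def lessThan_atLeast0)

lemma mat_vec_index:
  assumes "A \<in> carrier_mat n m" "v \<in> carrier_vec m" "i < n"
  shows "(A *\<^sub>v v) $ i = (\<Sum>k<m. A $$ (i, k) * v $ k)"
  using assms by (auto simp: scalar_prod_def lessThan_atLeast0)

lemma dagger_mult:
  assumes "A \<in> carrier_mat n m" "B \<in> carrier_mat m l"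
  shows "dagger (A * B) = dagger B * dagger A"
proof (rule eq_matI)
  fix i j assume "i < dim_row (dagger B * dagger A)" "j < dim_col (dagger B * dagger A)"
  then have ij: "i < l" "j < n" using assms by auto
  have "dagger (A * B) $$ (i, j) = cnj (\<Sum>k<m. A $$ (j, k) * B $$ (k, i))"
    using assms ij by (subst mat_mult_index[symmetric, OF assms ij(2,1)]) auto
  also have "\<dots> = (\<Sum>k<m. dagger B $$ (i, k) * dagger A $$ (k, j))"
    using assms ij by (auto simp: mult.commute intro!: sum.cong)
  also have "\<dots> = (dagger B * dagger A) $$ (i, j)"
    using assms ij by (subst mat_mult_index[of _ l m _ n]) auto
  finally show "dagger (A * B) $$ (i, j) = (dagger B * dagger A) $$ (i, j)" .
qed (use assms in auto)

lemma cinner_eq_sum: "v \<in> carrier_vec n \<Longrightarrow> cinner u v = (\<Sum>i<n. cnj (u $ i) * v $ i)"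
  by (auto simp: cinner_def)

lemma cinner_adjoint:
  assumes "A \<in> carrier_mat n m" "u \<in> carrier_vec n" "v \<in> carrier_vec m"
  shows "cinner u (A *\<^sub>v v) = cinner (dagger A *\<^sub>v u) v"
proof -
  have "cinner u (A *\<^sub>v v) = (\<Sum>i<n. cnj (u $ i) * (\<Sum>k<m. A $$ (i, k) * v $ k))"
    using assms by (subst cinner_eq_sum[of _ n]) (auto simp: mat_vec_index simp del: index_mult_mat_vec intro!: sum.cong)
  also have "\<dots> = (\<Sum>k<m. \<Sum>i<n. cnj (u $ i) * A $$ (i, k) * v $ k)"
    by (subst sum.swap) (simp add: sum_distrib_left mult.assoc)
  also have "\<dots> = (\<Sum>k<m. cnj ((dagger A *\<^sub>v u) $ k) * v $ k)"
    using assms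
    by (intro sum.cong refl, subst mat_vec_index[of _ m n])
      (auto simp: sum_distrib_left mult.commute intro!: sum.cong)
  also have "\<dots> = cinner (dagger A *\<^sub>v u) v"
    using assms by (subst cinner_eq_sum[of v m]) auto
  finally show ?thesis .
qed

lemma cinner_commute:
  assumes "u \<in> carrier_vec n" "v \<in> carrier_vec n"
  shows "cinner u v = cnj (cinner v u)"
  using assms by (simp add: cinner_def mult.commute)

lemma cinner_self: "v \<in> carrier_vec n \<Longrightarrow> cinner v v = complex_of_real (\<Sum>i<n. (cmod (v $ i))\<^sup>2)"
  by (simp add: cinner_eq_sum complex_norm_square[symmetric] mult.commute[of "cnj _"])

lemma cinner_self_eq_0:
  assumes "v \<in> carrier_vec n" "cinner v v = 0"
  shows "v = 0\<^sub>v n"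
proof -
  have "(\<Sum>i<n. (cmod (v $ i))\<^sup>2) = 0"
    using assms(2) unfolding cinner_self[OF assms(1)] of_real_eq_0_iff .
  then show ?thesis using assms(1) by (intro eq_vecI) (auto simp: sum_nonneg_eq_0_iff)
qed

lemma cinner_add_right:
  "v \<in> carrier_vec n \<Longrightarrow> w \<in> carrier_vec n \<Longrightarrow> cinner u (v + w) = cinner u v + cinner u w"
  by (simp add: cinner_def algebra_simps sum.distrib)

lemma cinner_smult_right: "cinner u (c \<cdot>\<^sub>v v) = c * cinner u v"
  by (simp add: cinner_def sum_distrib_left mult.left_commute)

lemma cinner_smult_left:
  "u \<in> carrier_vec n \<Longrightarrow> v \<in> carrier_vec n \<Longrightarrow> cinner (c \<cdot>\<^sub>v u) v = cnj c * cinner u v"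
  by (simp add: cinner_def sum_distrib_left mult.assoc)

text \<open>Turns a Kraus term on a rank one operator into the action of the Kraus operator on two
  vectors, where permutations and tensor factors are easy to follow.\<close>

lemma conj_outer:
  assumes "A \<in> carrier_mat n m" "B \<in> carrier_mat n m" "u \<in> carrier_vec m" "v \<in> carrier_vec m"
  shows "A * outer u v * dagger B = outer (A *\<^sub>v u) (B *\<^sub>v v)"
proof (rule eq_matI)
  fix i j assume "i < dim_row (outer (A *\<^sub>v u) (B *\<^sub>v v))" "j < dim_col (outer (A *\<^sub>v u) (B *\<^sub>v v))"
  then have ij: "i < n" "j < n" using assms by (auto simp: outer_def)
  have 1: "(A * outer u v) $$ (i, k) = (A *\<^sub>v u) $ i * cnj (v $ k)" if "k < m" for k
    using assms ij that
    by (subst mat_mult_index[of _ n m _ m])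
      (auto simp: mat_vec_index[of A n m] outer_def sum_distrib_right mult.assoc intro!: sum.cong
            simp del: index_mult_mat_vec)
  have 2: "(B *\<^sub>v v) $ j = (\<Sum>k<m. B $$ (j, k) * v $ k)"
    using assms ij by (intro mat_vec_index) auto
  have "(A * outer u v * dagger B) $$ (i, j) = (\<Sum>k<m. (A * outer u v) $$ (i, k) * dagger B $$ (k, j))"
    using assms ij by (intro mat_mult_index) auto
  also have "\<dots> = (\<Sum>k<m. (A *\<^sub>v u) $ i * cnj (v $ k) * cnj (B $$ (j, k)))"
    using 1 assms ij by (intro sum.cong) auto
  also have "\<dots> = (A *\<^sub>v u) $ i * cnj ((B *\<^sub>v v) $ j)"
    unfolding 2 by (simp add: sum_distrib_left mult_ac)
  also have "\<dots> = outer (A *\<^sub>v u) (B *\<^sub>v v) $$ (i, j)"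
    using assms ij by (simp add: outer_def)
  finally show "(A * outer u v * dagger B) $$ (i, j) = outer (A *\<^sub>v u) (B *\<^sub>v v) $$ (i, j)" .
qed (use assms in \<open>auto simp: outer_def\<close>)

section \<open>Kronecker products\<close>

lemma sum_lessThan_mult:
  fixes f :: "nat \<Rightarrow> 'a::comm_monoid_add"
  shows "(\<Sum>k<n * m. f k) = (\<Sum>i<n. \<Sum>j<m. f (i * m + j))"
proof -
  have "(\<Sum>k<n * m. f k) = (\<Sum>i<n. sum f {i * m..<i * m + m})"
    by (rule sum.nat_group[symmetric])
  also have "\<dots> = (\<Sum>i<n. \<Sum>j<m. f (i * m + j))"
    using sum.shift_bounds_nat_ivl[of f 0 _ m]
    by (simp add: lessThan_atLeast0 add.commute[of m] add.commute[of _ "_ * m"])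
  finally show ?thesis .
qed

lemma mult_add_less: "i < n \<Longrightarrow> j < m \<Longrightarrow> i * m + j < n * (m::nat)"
  proof -
  assume "i < n" "j < m"
  then have "i * m + j < Suc i * m" "Suc i * m \<le> n * m"
    using mult_le_mono1[of "Suc i" n m] by auto
  then show ?thesis by (rule less_le_trans)
qed

lemma div_mod_less: "k < n * m \<Longrightarrow> k div m < n \<and> k mod m < (m::nat)"
  by (metis less_mult_imp_div_less mod_less_divisor mult_0_right neq0_conv not_less_zero)

text \<open>Both groupings of a triple product read the same three digits off an index. Hence
  \<open>kron_vec\<close> and \<open>kron_mat\<close> are associative as equalities, without any
  reindexing map.\<close>

lemma div_mod_assoc:
  "k mod (b * c) div c = k div c mod (b::nat)" "k mod (b * c) mod c = k mod c"
  "k div (b * c) = k div c div b"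
  by (auto simp: mod_mult2_eq div_mult2_eq mult.commute[of b c])
    (cases "c = 0"; simp add: div_mult2_eq)+

lemma kron_vec_carrier [simp]:
  "u \<in> carrier_vec n \<Longrightarrow> v \<in> carrier_vec m \<Longrightarrow> kron_vec u v \<in> carrier_vec (n * m)"
  by (auto simp: kron_vec_def)

lemma kron_vec_dim [simp]: "dim_vec (kron_vec u v) = dim_vec u * dim_vec v"
  by (simp add: kron_vec_def)

lemma kron_vec_index:
  "v \<in> carrier_vec m \<Longrightarrow> i < dim_vec u \<Longrightarrow> j < m \<Longrightarrow> kron_vec u v $ (i * m + j) = u $ i * v $ j"
  by (auto simp: kron_vec_def mult_add_less)

lemma kron_vec_assoc: "kron_vec u (kron_vec v w) = kron_vec (kron_vec u v) w"
proof (rule eq_vecI)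
  fix k assume "k < dim_vec (kron_vec (kron_vec u v) w)"
  then have k: "k < dim_vec u * dim_vec v * dim_vec w" by simp
  then have "k < dim_vec u * (dim_vec v * dim_vec w)" by (simp add: mult.assoc)
  with k div_mod_less[OF k] div_mod_less[OF this]
  show "kron_vec u (kron_vec v w) $ k = kron_vec (kron_vec u v) w $ k"
    by (auto simp: kron_vec_def div_mod_assoc mult.assoc)
qed (simp add: mult.assoc)

lemma kron_vec_smult_right: "kron_vec u (c \<cdot>\<^sub>v v) = c \<cdot>\<^sub>v kron_vec u v"
proof (rule eq_vecI)
  fix k assume "k < dim_vec (c \<cdot>\<^sub>v kron_vec u v)"
  then have k: "k < dim_vec u * dim_vec v" by simp
  with div_mod_less[OF this] show "kron_vec u (c \<cdot>\<^sub>v v) $ k = (c \<cdot>\<^sub>v kron_vec u v) $ k"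
    by (simp add: kron_vec_def)
qed simp

lemma cinner_kron:
  assumes "u \<in> carrier_vec n" "u' \<in> carrier_vec n" "v \<in> carrier_vec m" "v' \<in> carrier_vec m"
  shows "cinner (kron_vec u v) (kron_vec u' v') = cinner u u' * cinner v v'"
proof -
  have "cinner (kron_vec u v) (kron_vec u' v') =
      (\<Sum>i<n. \<Sum>j<m. cnj (u $ i) * u' $ i * (cnj (v $ j) * v' $ j))"
    using assms
    by (subst cinner_eq_sum[of _ "n * m"], simp, subst sum_lessThan_mult)
      (auto simp: kron_vec_index intro!: sum.cong)
  then show ?thesis
    using assms by (simp add: cinner_eq_sum[of u' n] cinner_eq_sum[of v' m] sum_product)
qed

section \<open>Kronecker products of matrices\<close>

definition kron_mat :: "complex mat \<Rightarrow> complex mat \<Rightarrow> complex mat" where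
  "kron_mat A B = mat (dim_row A * dim_row B) (dim_col A * dim_col B)
     (\<lambda>(i,j). A $$ (i div dim_row B, j div dim_col B) * B $$ (i mod dim_row B, j mod dim_col B))"

lemma kron_mat_carrier [simp]:
  "A \<in> carrier_mat n m \<Longrightarrow> B \<in> carrier_mat k l \<Longrightarrow> kron_mat A B \<in> carrier_mat (n * k) (m * l)"
  by (auto simp: kron_mat_def)

lemma kron_mat_dim [simp]:
  "dim_row (kron_mat A B) = dim_row A * dim_row B" "dim_col (kron_mat A B) = dim_col A * dim_col B"
  by (auto simp: kron_mat_def)

lemma kron_mat_index:
  assumes "A \<in> carrier_mat n m" "B \<in> carrier_mat k l" "i < n * k" "j < m * l"
  shows "kron_mat A B $$ (i, j) = A $$ (i div k, j div l) * B $$ (i mod k, j mod l)"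
  using assms by (auto simp: kron_mat_def)

text \<open>Comparing entries digit by digit keeps \<open>div\<close> and \<open>mod\<close> out of
  the proofs that use this rule.\<close>

lemma kron_mat_eqI:
  assumes "C \<in> carrier_mat (n * k) (m * l)" "A \<in> carrier_mat n m" "B \<in> carrier_mat k l"
    and "\<And>i i' j j'. i < n \<Longrightarrow> i' < k \<Longrightarrow> j < m \<Longrightarrow> j' < l \<Longrightarrow>
      C $$ (i * k + i', j * l + j') = A $$ (i, j) * B $$ (i', j')"
  shows "kron_mat A B = C"
proof (rule eq_matI)
  fix i j assume "i < dim_row C" "j < dim_col C"
  then have ij: "i < n * k" "j < m * l" using assms by auto
  from assms(4)[of "i div k" "i mod k" "j div l" "j mod l"] div_mod_less[OF ij(1)] div_mod_less[OF ij(2)]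
  show "kron_mat A B $$ (i, j) = C $$ (i, j)"
    using assms(2,3) ij by (simp add: kron_mat_index)
qed (use assms in auto)

lemma kron_mat_mult:
  assumes "A \<in> carrier_mat n m" "B \<in> carrier_mat k l" "A' \<in> carrier_mat m p" "B' \<in> carrier_mat l q"
  shows "kron_mat A B * kron_mat A' B' = kron_mat (A * A') (B * B')"
proof (rule kron_mat_eqI[symmetric, where n = n and m = p and k = k and l = q])
  fix i i' j j' assume h: "i < n" "i' < k" "j < p" "j' < q"
  have "(kron_mat A B * kron_mat A' B') $$ (i * k + i', j * q + j') =
      (\<Sum>s<m * l. kron_mat A B $$ (i * k + i', s) * kron_mat A' B' $$ (s, j * q + j'))"
    using assms h by (intro mat_mult_index) (auto simp: mult_add_less)
  also have "\<dots> = (\<Sum>s<m. \<Sum>t<l. (A $$ (i, s) * A' $$ (s, j)) * (B $$ (i', t) * B' $$ (t, j')))"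
    using assms h unfolding sum_lessThan_mult
    by (intro sum.cong refl) (auto simp: kron_mat_index[of _ n m _ k l] kron_mat_index[of _ m p _ l q] mult_add_less)
  also have "\<dots> = (A * A') $$ (i, j) * (B * B') $$ (i', j')"
    using assms h by (simp add: mat_mult_index[of _ n m _ p] mat_mult_index[of _ k l _ q] sum_product
        del: index_mult_mat)
  finally show "(kron_mat A B * kron_mat A' B') $$ (i * k + i', j * q + j') =
      (A * A') $$ (i, j) * (B * B') $$ (i', j')" .
qed (use assms in auto)

lemma kron_mat_vec:
  assumes "A \<in> carrier_mat n m" "B \<in> carrier_mat k l" "u \<in> carrier_vec m" "v \<in> carrier_vec l"
  shows "kron_mat A B *\<^sub>v kron_vec u v = kron_vec (A *\<^sub>v u) (B *\<^sub>v v)"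
proof (rule eq_vecI)
  fix i assume "i < dim_vec (kron_vec (A *\<^sub>v u) (B *\<^sub>v v))"
  then have i: "i < n * k" using assms by auto
  then have ik: "i div k < n" "i mod k < k" using div_mod_less by blast+
  have "(kron_mat A B *\<^sub>v kron_vec u v) $ i = (\<Sum>s<m * l. kron_mat A B $$ (i, s) * kron_vec u v $ s)"
    using assms i by (intro mat_vec_index) auto
  also have "\<dots> = (\<Sum>s<m. \<Sum>t<l. (A $$ (i div k, s) * u $ s) * (B $$ (i mod k, t) * v $ t))"
    using assms i unfolding sum_lessThan_mult
    by (intro sum.cong refl) (auto simp: kron_mat_index[of _ n m _ k l] kron_vec_index mult_add_less)
  also have "\<dots> = (A *\<^sub>v u) $ (i div k) * (B *\<^sub>v v) $ (i mod k)"
    using assms ik by (simp add: mat_vec_index[of _ n m] mat_vec_index[of _ k l] sum_product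
        del: index_mult_mat_vec)
  also have "\<dots> = kron_vec (A *\<^sub>v u) (B *\<^sub>v v) $ i"
    using assms i by (auto simp: kron_vec_def)
  finally show "(kron_mat A B *\<^sub>v kron_vec u v) $ i = kron_vec (A *\<^sub>v u) (B *\<^sub>v v) $ i" .
qed (use assms in auto)

lemma kron_mat_dagger: "dagger (kron_mat A B) = kron_mat (dagger A) (dagger B)"
proof (rule kron_mat_eqI[symmetric, where n = "dim_col A" and m = "dim_row A"
      and k = "dim_col B" and l = "dim_row B"])
  fix i i' j j' assume "i < dim_col A" "i' < dim_col B" "j < dim_row A" "j' < dim_row B"
  then show "dagger (kron_mat A B) $$ (i * dim_col B + i', j * dim_row B + j') =
      dagger A $$ (i, j) * dagger B $$ (i', j')"
    by (simp add: mult_add_less kron_mat_index[OF carrier_matI carrier_matI])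
qed (auto intro!: carrier_matI)

lemma kron_mat_one: "kron_mat (1\<^sub>m n) (1\<^sub>m m) = 1\<^sub>m (n * m)"
proof (rule kron_mat_eqI[where n = n and m = n and k = m and l = m])
  fix i i' j j' assume h: "i < n" "i' < m" "j < n" "j' < m"
  have "(i * m + i' = j * m + j') = (i = j \<and> i' = j')"
    using h by (metis add_right_cancel div_mult_self3 div_less mod_less mod_mult_self3 add_cancel_left_right
        less_nat_zero_code)
  then show "1\<^sub>m (n * m) $$ (i * m + i', j * m + j') = (1\<^sub>m n $$ (i, j) * 1\<^sub>m m $$ (i', j') :: complex)"
    using h by (auto simp: mult_add_less)
qed auto

lemma kron_mat_add_left:
  assumes "A \<in> carrier_mat n m" "B \<in> carrier_mat n m" "C \<in> carrier_mat k l"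
  shows "kron_mat (A + B) C = kron_mat A C + kron_mat B C"
  by (rule kron_mat_eqI[where n = n and m = m and k = k and l = l])
    (use assms in \<open>auto simp: kron_mat_index[of _ n m _ k l] mult_add_less distrib_right\<close>)

lemma kron_mat_smult_left: "kron_mat (c \<cdot>\<^sub>m A) C = c \<cdot>\<^sub>m kron_mat A C"
  by (rule kron_mat_eqI[where n = "dim_row A" and m = "dim_col A" and k = "dim_row C" and l = "dim_col C"])
    (auto simp: kron_mat_index[OF carrier_matI carrier_matI] mult_add_less intro!: carrier_matI)

lemma kron_mat_zero_left: "C \<in> carrier_mat k l \<Longrightarrow> kron_mat (0\<^sub>m n m) C = 0\<^sub>m (n * k) (m * l)"
  by (rule kron_mat_eqI[where n = n and m = m and k = k and l = l]) (auto simp: mult_add_less)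

lemma kron_mat_assoc: "kron_mat A (kron_mat B C) = kron_mat (kron_mat A B) C"
proof (rule eq_matI)
  fix i j assume "i < dim_row (kron_mat (kron_mat A B) C)" "j < dim_col (kron_mat (kron_mat A B) C)"
  then have i: "i < dim_row A * dim_row B * dim_row C" and j: "j < dim_col A * dim_col B * dim_col C"
    by auto
  then have i': "i < dim_row A * (dim_row B * dim_row C)" and j': "j < dim_col A * (dim_col B * dim_col C)"
    by (auto simp: mult.assoc)
  show "kron_mat A (kron_mat B C) $$ (i, j) = kron_mat (kron_mat A B) C $$ (i, j)"
    using i j i' j' div_mod_less[OF i] div_mod_less[OF j] div_mod_less[OF i'] div_mod_less[OF j']
    by (auto simp: kron_mat_def div_mod_assoc mult.assoc)
qed (simp_all add: mult.assoc)

lemma outer_kron: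
  assumes "u \<in> carrier_vec n" "u' \<in> carrier_vec m" "v \<in> carrier_vec k" "v' \<in> carrier_vec l"
  shows "kron_mat (outer u u') (outer v v') = outer (kron_vec u v) (kron_vec u' v')"
  by (rule kron_mat_eqI[where n = n and m = m and k = k and l = l])
    (use assms in \<open>auto simp: outer_def kron_vec_index mult_add_less\<close>)

lemma tpow_carrier [simp]: "v \<in> carrier_vec d \<Longrightarrow> tpow m v \<in> carrier_vec (d ^ m)"
  by (induction m) auto

section \<open>Channels\<close>

lemma foldr_add_carrier:
  assumes "\<And>K. K \<in> set Ks \<Longrightarrow> f K \<in> carrier_mat n m"
  shows "foldr (\<lambda>K S. f K + S) Ks (0\<^sub>m n m) \<in> carrier_mat n m"
  using assms by (induction Ks) auto

lemma foldr_add_append: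
  fixes f :: "'b \<Rightarrow> complex mat"
  assumes "\<And>K. K \<in> set Ks \<union> set Ls \<Longrightarrow> f K \<in> carrier_mat n m"
  shows "foldr (\<lambda>K S. f K + S) (Ks @ Ls) (0\<^sub>m n m) =
    foldr (\<lambda>K S. f K + S) Ks (0\<^sub>m n m) + foldr (\<lambda>K S. f K + S) Ls (0\<^sub>m n m)"
  using assms
proof (induction Ks)
  case Nil
  then show ?case using foldr_add_carrier[of Ls f n m] by auto
next
  case (Cons K Ks)
  then show ?case
    using foldr_add_carrier[of Ls f n m] foldr_add_carrier[of Ks f n m]
    by (auto simp: assoc_add_mat[of _ n m])
qed

lemma foldr_add_conj:
  fixes f :: "'b \<Rightarrow> complex mat"
  assumes "A \<in> carrier_mat k n" "B \<in> carrier_mat m l" "\<And>K. K \<in> set Ks \<Longrightarrow> f K \<in> carrier_mat n m"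
  shows "foldr (\<lambda>K S. A * f K * B + S) Ks (0\<^sub>m k l) = A * foldr (\<lambda>K S. f K + S) Ks (0\<^sub>m n m) * B"
  using assms(3)
proof (induction Ks)
  case Nil
  show ?case using assms(1,2) by auto
next
  case (Cons K Ks)
  have "foldr (\<lambda>K S. f K + S) Ks (0\<^sub>m n m) \<in> carrier_mat n m"
    using Cons.prems by (intro foldr_add_carrier) auto
  then show ?case
    using Cons assms(1,2)
    by (simp add: mult_add_distrib_mat[of A k n _ m] add_mult_distrib_mat[of _ k m _ _ l])
qed

text \<open>Matrices of all sizes share one type, so a Kraus sum is a fold from a zero matrix of
  explicit size; entrywise it becomes an ordinary list sum.\<close>

lemma foldr_add_index:
  fixes f :: "'b \<Rightarrow> complex mat"
  assumes "\<And>K. K \<in> set Ks \<Longrightarrow> f K \<in> carrier_mat n m" "i < n" "j < m"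
  shows "foldr (\<lambda>K S. f K + S) Ks (0\<^sub>m n m) $$ (i, j) = (\<Sum>K\<leftarrow>Ks. f K $$ (i, j))"
  using assms
proof (induction Ks)
  case (Cons K Ks)
  have "foldr (\<lambda>K S. f K + S) Ks (0\<^sub>m n m) \<in> carrier_mat n m"
    using Cons.prems by (intro foldr_add_carrier) auto
  then show ?case using Cons by auto
qed auto

lemma kraus_term_carrier [simp]:
  "K \<in> carrier_mat d D \<Longrightarrow> \<rho> \<in> carrier_mat D D \<Longrightarrow> K * \<rho> * dagger K \<in> carrier_mat d d"
  by (metis dagger_carrier mult_carrier_mat)

lemma apply_channel_carrier:
  assumes "kraus_channel D d Ks" "\<rho> \<in> carrier_mat D D"
  shows "apply_channel D d Ks \<rho> \<in> carrier_mat d d"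
  unfolding apply_channel_def using assms
  by (intro foldr_add_carrier kraus_term_carrier[of _ d D]) (auto simp: kraus_channel_def)

lemma apply_channel_add:
  assumes "\<And>K. K \<in> set Ks \<Longrightarrow> K \<in> carrier_mat d D" "A \<in> carrier_mat D D" "B \<in> carrier_mat D D"
  shows "apply_channel D d Ks (A + B) = apply_channel D d Ks A + apply_channel D d Ks B"
proof -
  have car: "apply_channel D d Ks X \<in> carrier_mat d d" if "X \<in> carrier_mat D D" for X
    unfolding apply_channel_def using assms that by (intro foldr_add_carrier kraus_term_carrier[of _ d D]) auto
  note [simp] = carrier_matD[OF car]
  show ?thesis
  proof (rule eq_matI)
    fix i j assume "i < dim_row (apply_channel D d Ks A + apply_channel D d Ks B)"
      "j < dim_col (apply_channel D d Ks A + apply_channel D d Ks B)"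
    then have ij: "i < d" "j < d" using assms by auto
    have "(K * (A + B) * dagger K) $$ (i, j) = (K * A * dagger K) $$ (i, j) + (K * B * dagger K) $$ (i, j)"
      if "K \<in> set Ks" for K
    proof -
      have K: "K \<in> carrier_mat d D" "dagger K \<in> carrier_mat D d" using assms that by auto
      have "K * (A + B) * dagger K = K * A * dagger K + K * B * dagger K"
        using K assms by (simp add: mult_add_distrib_mat[of K d D _ D] add_mult_distrib_mat[of _ d D _ _ d])
      moreover have "K * B * dagger K \<in> carrier_mat d d" using K assms by simp
      ultimately show ?thesis using ij by auto
    qed
    then have "apply_channel D d Ks (A + B) $$ (i, j) =
        apply_channel D d Ks A $$ (i, j) + apply_channel D d Ks B $$ (i, j)"
      unfolding apply_channel_def using assms ij
      by (subst (1 2 3) foldr_add_index) (auto simp: sum_list_addf[symmetric] intro!: kraus_term_carrier[of _ d D] cong: map_cong)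
    then show "apply_channel D d Ks (A + B) $$ (i, j) = (apply_channel D d Ks A + apply_channel D d Ks B) $$ (i, j)"
      using assms ij by simp
  qed (use assms in auto)
qed

lemma apply_channel_smult:
  assumes "\<And>K. K \<in> set Ks \<Longrightarrow> K \<in> carrier_mat d D" "A \<in> carrier_mat D D"
  shows "apply_channel D d Ks (c \<cdot>\<^sub>m A) = c \<cdot>\<^sub>m apply_channel D d Ks A"
  using assms(1)
proof (induction Ks)
  case (Cons K Ks)
  have K: "K \<in> carrier_mat d D" "dagger K \<in> carrier_mat D d" using Cons by auto
  have "K * (c \<cdot>\<^sub>m A) * dagger K = c \<cdot>\<^sub>m (K * A * dagger K)"
    using K assms by (simp add: mult_smult_distrib[of K d D _ D] mult_smult_assoc_mat[of _ d D _ d])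
  moreover have "apply_channel D d Ks A \<in> carrier_mat d d"
    unfolding apply_channel_def using Cons assms by (intro foldr_add_carrier kraus_term_carrier[of _ d D]) auto
  moreover have "K * A * dagger K \<in> carrier_mat d d" using K assms by simp
  ultimately show ?case using Cons
    by (simp add: apply_channel_def add_smult_distrib_left_mat[of _ d d])
qed (simp add: apply_channel_def)

lemma kraus_channel_isometry:
  assumes "V \<in> carrier_mat n m" "dagger V * V = 1\<^sub>m m"
  shows "kraus_channel m n [V]"
    and "\<rho> \<in> carrier_mat m m \<Longrightarrow> apply_channel m n [V] \<rho> = V * \<rho> * dagger V"
  using assms kraus_term_carrier[OF assms(1)] by (auto simp: kraus_channel_def apply_channel_def)

text \<open>The composite has all products \<open>L * K\<close> as Kraus operators. In its
  completeness relation the sum over \<open>L\<close> collapses to the identity between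
  \<open>dagger K\<close> and \<open>K\<close>, which leaves the relation for
  \<open>Ks\<close>.\<close>

lemma channel_comp:
  assumes "kraus_channel D E Ks" "kraus_channel E d Ls"
  obtains Ms where "kraus_channel D d Ms"
    "\<And>\<rho>. \<rho> \<in> carrier_mat D D \<Longrightarrow>
      apply_channel D d Ms \<rho> = apply_channel E d Ls (apply_channel D E Ks \<rho>)"
proof
  define F where "F Ks = concat (map (\<lambda>K. map (\<lambda>L. L * K) Ls) Ks)" for Ks :: "complex mat list"
  have F_Cons: "F (K # Ks) = map (\<lambda>L. L * K) Ls @ F Ks" for K Ks by (simp add: F_def)
  have L: "\<And>L. L \<in> set Ls \<Longrightarrow> L \<in> carrier_mat d E"
    and Lsum: "foldr (\<lambda>K S. dagger K * K + S) Ls (0\<^sub>m E E) = 1\<^sub>m E"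
    and K: "\<And>K. K \<in> set Ks \<Longrightarrow> K \<in> carrier_mat E D"
    and Ksum: "foldr (\<lambda>K S. dagger K * K + S) Ks (0\<^sub>m D D) = 1\<^sub>m D"
    using assms by (auto simp: kraus_channel_def)
  have F_car: "\<And>M. M \<in> set (F Ks) \<Longrightarrow> M \<in> carrier_mat d D"
    if "\<And>K. K \<in> set Ks \<Longrightarrow> K \<in> carrier_mat E D" for Ks
    using that L by (auto simp: F_def intro!: mult_carrier_mat[of _ d E _ D])
  have "foldr (\<lambda>K S. dagger K * K + S) (F Ks) (0\<^sub>m D D) = foldr (\<lambda>K S. dagger K * K + S) Ks (0\<^sub>m D D)"
    using K
  proof (induction Ks)
    case (Cons K Ks)
    have K: "K \<in> carrier_mat E D" using Cons by auto
    have eq: "dagger (L * K) * (L * K) = dagger K * (dagger L * L) * K" if "L \<in> set Ls" for L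
    proof -
      note c = K L[OF that] dagger_carrier[OF K] dagger_carrier[OF L[OF that]]
      then have "dagger L * L \<in> carrier_mat E E" by (intro mult_carrier_mat)
      with c show ?thesis
        by (simp add: dagger_mult[of L d E K D] assoc_mult_mat[of _ D E _ d _ D]
            assoc_mult_mat[of _ D E _ E _ D] assoc_mult_mat[of _ E d _ E _ D])
    qed
    have "foldr (\<lambda>M S. dagger M * M + S) (map (\<lambda>L. L * K) Ls) (0\<^sub>m D D) =
        foldr (\<lambda>L S. dagger K * (dagger L * L) * K + S) Ls (0\<^sub>m D D)"
      unfolding foldr_map using eq by (intro foldr_cong) auto
    also have "\<dots> = dagger K * 1\<^sub>m E * K"
      using L K by (subst foldr_add_conj[of _ D E _ E D]) (auto simp: Lsum intro!: mult_carrier_mat[of _ E d])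
    also have "\<dots> = dagger K * K" using K right_mult_one_mat[OF dagger_carrier[OF K]] by simp
    finally have "foldr (\<lambda>M S. dagger M * M + S) (map (\<lambda>L. L * K) Ls) (0\<^sub>m D D) = dagger K * K" .
    moreover have "dagger M * M \<in> carrier_mat D D" if "M \<in> set (map (\<lambda>L. L * K) Ls) \<union> set (F Ks)" for M
      using F_car[of "K # Ks" M] Cons.prems that unfolding F_Cons by (auto intro!: mult_carrier_mat[of _ D d])
    ultimately show ?case
      using Cons unfolding F_Cons by (subst foldr_add_append) auto
  qed (simp add: F_def)
  then show "kraus_channel D d (F Ks)"
    using F_car K Ksum by (auto simp: kraus_channel_def)
  fix \<rho> :: "complex mat" assume \<rho>: "\<rho> \<in> carrier_mat D D"
  show "apply_channel D d (F Ks) \<rho> = apply_channel E d Ls (apply_channel D E Ks \<rho>)"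
    using K
  proof (induction Ks)
    case Nil
    have L: "\<And>L. L \<in> set Ls \<Longrightarrow> L \<in> carrier_mat d E" using assms(2) by (auto simp: kraus_channel_def)
    \<comment> \<open>The zero matrix is its own multiple by 0, so homogeneity of the channel gives
      the value at zero.\<close>
    have "apply_channel E d Ls (0\<^sub>m E E) = 0 \<cdot>\<^sub>m apply_channel E d Ls (0\<^sub>m E E)"
      using apply_channel_smult[of Ls d E "0\<^sub>m E E" 0, OF L] by (auto simp: smult_zero_mat)
    also have "\<dots> = 0\<^sub>m d d"
      using apply_channel_carrier[OF assms(2), of "0\<^sub>m E E"] by (intro eq_matI) auto
    finally show ?case by (simp add: apply_channel_def F_def)
  next
    case (Cons K Ks)
    have K: "K \<in> carrier_mat E D" using Cons by auto
    have eq: "L * K * \<rho> * dagger (L * K) = L * (K * \<rho> * dagger K) * dagger L" if "L \<in> set Ls" for L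
    proof -
      note c = K L[OF that] dagger_carrier[OF K] dagger_carrier[OF L[OF that]] \<rho>
      then have "K * \<rho> \<in> carrier_mat E D" "L * (K * \<rho>) \<in> carrier_mat d D" by auto
      with c show ?thesis
        by (simp add: dagger_mult[of L d E K D] assoc_mult_mat[of L d E K D \<rho> D]
           assoc_mult_mat[of L d E "K * \<rho>" D "dagger K" E]
           assoc_mult_mat[of "L * (K * \<rho>)" d D "dagger K" E "dagger L" d, symmetric])
    qed
    have cK: "K * \<rho> * dagger K \<in> carrier_mat E E" using K \<rho> by simp
    have cKs: "apply_channel D E Ks \<rho> \<in> carrier_mat E E"
      unfolding apply_channel_def using Cons.prems \<rho> by (intro foldr_add_carrier kraus_term_carrier[of _ E D]) auto
    have "apply_channel D d (F (K # Ks)) \<rho> =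
        apply_channel D d (map (\<lambda>L. L * K) Ls) \<rho> + apply_channel D d (F Ks) \<rho>"
      unfolding F_Cons apply_channel_def
      using F_car[of "K # Ks"] Cons.prems \<rho> unfolding F_Cons
      by (intro foldr_add_append) (auto intro!: kraus_term_carrier[of _ d D])
    also have "apply_channel D d (map (\<lambda>L. L * K) Ls) \<rho> = apply_channel E d Ls (K * \<rho> * dagger K)"
      unfolding apply_channel_def foldr_map using eq by (intro foldr_cong) auto
    also have "apply_channel D d (F Ks) \<rho> = apply_channel E d Ls (apply_channel D E Ks \<rho>)"
      using Cons by auto
    also have "apply_channel E d Ls (K * \<rho> * dagger K) + \<dots> =
        apply_channel E d Ls (K * \<rho> * dagger K + apply_channel D E Ks \<rho>)"
      using L cK cKs by (intro apply_channel_add[symmetric]) auto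
    finally show ?case by (simp add: apply_channel_def)
  qed
qed

text \<open>Lets a step act on the front registers while the copies meant for later steps wait. The
  Kraus operators are those of \<open>Ks\<close> tensored with the identity.\<close>

lemma channel_tensor_id:
  assumes "kraus_channel D d Ks"
  obtains Ms where "kraus_channel (D * e) (d * e) Ms"
    "\<And>A B. A \<in> carrier_mat D D \<Longrightarrow> B \<in> carrier_mat e e \<Longrightarrow>
      apply_channel (D * e) (d * e) Ms (kron_mat A B) = kron_mat (apply_channel D d Ks A) B"
proof
  let ?F = "map (\<lambda>K. kron_mat K (1\<^sub>m e))"
  have K: "\<And>K. K \<in> set Ks \<Longrightarrow> K \<in> carrier_mat d D"
    and Ksum: "foldr (\<lambda>K S. dagger K * K + S) Ks (0\<^sub>m D D) = 1\<^sub>m D"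
    using assms by (auto simp: kraus_channel_def)
  have "foldr (\<lambda>K S. dagger K * K + S) (?F Ks) (0\<^sub>m (D * e) (D * e)) =
      kron_mat (foldr (\<lambda>K S. dagger K * K + S) Ks (0\<^sub>m D D)) (1\<^sub>m e)"
    using K
  proof (induction Ks)
    case (Cons K Ks)
    have K: "K \<in> carrier_mat d D" using Cons by auto
    have "foldr (\<lambda>K S. dagger K * K + S) Ks (0\<^sub>m D D) \<in> carrier_mat D D"
      using Cons.prems by (intro foldr_add_carrier) (auto intro!: mult_carrier_mat[of _ D d])
    then show ?case
      using K Cons dagger_carrier[OF K] mult_carrier_mat[OF dagger_carrier[OF K] K]
      by (simp add: kron_mat_dagger kron_mat_mult[of _ D d _ e e _ D _ e] kron_mat_add_left[of _ D D _ _ e e])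
  qed (simp add: kron_mat_zero_left[of _ e e])
  then show "kraus_channel (D * e) (d * e) (?F Ks)"
    using K by (auto simp: kraus_channel_def Ksum kron_mat_one)
  fix A B :: "complex mat" assume A: "A \<in> carrier_mat D D" and B: "B \<in> carrier_mat e e"
  show "apply_channel (D * e) (d * e) (?F Ks) (kron_mat A B) = kron_mat (apply_channel D d Ks A) B"
    using K
  proof (induction Ks)
    case Nil
    show ?case using B by (simp add: apply_channel_def kron_mat_zero_left)
  next
    case (Cons K Ks)
    have K: "K \<in> carrier_mat d D" using Cons by auto
    have "apply_channel D d Ks A \<in> carrier_mat d d"
      unfolding apply_channel_def using Cons A by (intro foldr_add_carrier kraus_term_carrier[of _ d D]) auto
    moreover have "kron_mat K (1\<^sub>m e) * kron_mat A B * dagger (kron_mat K (1\<^sub>m e)) = kron_mat (K * A * dagger K) B"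
      using K A B dagger_carrier[OF K] mult_carrier_mat[OF K A]
      by (simp add: kron_mat_dagger kron_mat_mult[of _ d D _ e e _ D _ e] kron_mat_mult[of _ d D _ e e _ d _ e])
    ultimately show ?case
      using K Cons A B kraus_term_carrier[OF K A]
      by (simp add: apply_channel_def kron_mat_add_left[of _ d d _ _ e e])
  qed
qed

text \<open>Discarding a register is a channel whose Kraus operators pair that register with its
  basis vectors; \<open>K r\<close> selects the rows with second digit \<open>r\<close>.\<close>

lemma channel_partial_trace:
  obtains Ks where "kraus_channel (d * e) d Ks"
    "\<And>\<rho>. \<rho> \<in> carrier_mat (d * e) (d * e) \<Longrightarrow>
      apply_channel (d * e) d Ks \<rho> = mat d d (\<lambda>(i, j). \<Sum>r<e. \<rho> $$ (i * e + r, j * e + r))"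
proof
  define K :: "nat \<Rightarrow> complex mat" where
    "K r = mat d (d * e) (\<lambda>(i, k). if k = i * e + r then 1 else 0)" for r
  have K: "K r \<in> carrier_mat d (d * e)" for r by (simp add: K_def)
  have Ks: "(\<Sum>L\<leftarrow>map K [0..<e]. f L) = (\<Sum>r<e. f (K r))" for f :: "complex mat \<Rightarrow> complex"
    by (simp add: sum_list_distinct_conv_sum_set lessThan_atLeast0 comp_def)
  have "foldr (\<lambda>K S. dagger K * K + S) (map K [0..<e]) (0\<^sub>m (d * e) (d * e)) = 1\<^sub>m (d * e)"
  proof (rule eq_matI)
    fix k l assume "k < dim_row (1\<^sub>m (d * e))" "l < dim_col (1\<^sub>m (d * e))"
    then have kl: "k < d * e" "l < d * e" by auto
    note dm = div_mod_less[OF kl(1)]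
    have "(dagger (K r) * K r) $$ (k, l) =
        (if r = k mod e then (if k = l then 1 else 0) else 0)" if "r < e" for r
    proof -
      have "(dagger (K r) * K r) $$ (k, l) = (\<Sum>i<d. dagger (K r) $$ (k, i) * K r $$ (i, l))"
        using K kl by (intro mat_mult_index) auto
      also have "\<dots> = (\<Sum>i<d. if i = k div e then (if r = k mod e \<and> k = l then 1 else 0) else 0)"
      proof (intro sum.cong refl)
        fix i assume i: "i \<in> {..<d}"
        have "(k = i * e + r) = (i = k div e \<and> r = k mod e)"
          using that by auto
        moreover have "dagger (K r) $$ (k, i) = cnj (K r $$ (i, k))" 
          using K[of r] kl i by simp
        ultimately show "dagger (K r) $$ (k, i) * K r $$ (i, l) =
            (if i = k div e then (if r = k mod e \<and> k = l then 1 else 0) else 0)"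
          using kl i by (auto simp: K_def)
      qed
      finally show ?thesis using dm by auto
    qed
    then show "foldr (\<lambda>K S. dagger K * K + S) (map K [0..<e]) (0\<^sub>m (d * e) (d * e)) $$ (k, l) = 1\<^sub>m (d * e) $$ (k, l)"
      using K kl dm by (subst foldr_add_index) (auto simp del: map_map simp: Ks intro!: mult_carrier_mat[of _ "d * e" d])
  next
    have "foldr (\<lambda>K S. dagger K * K + S) (map K [0..<e]) (0\<^sub>m (d * e) (d * e)) \<in> carrier_mat (d * e) (d * e)"
      using K by (intro foldr_add_carrier) (auto intro!: mult_carrier_mat[of _ "d * e" d])
    then show "dim_row (foldr (\<lambda>K S. dagger K * K + S) (map K [0..<e]) (0\<^sub>m (d * e) (d * e))) = dim_row (1\<^sub>m (d * e))"
       "dim_col (foldr (\<lambda>K S. dagger K * K + S) (map K [0..<e]) (0\<^sub>m (d * e) (d * e))) = dim_col (1\<^sub>m (d * e))" by auto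
  qed
  then show kc: "kraus_channel (d * e) d (map K [0..<e])"
    using K by (auto simp: kraus_channel_def)
  fix \<rho> :: "complex mat" assume \<rho>: "\<rho> \<in> carrier_mat (d * e) (d * e)"
  show "apply_channel (d * e) d (map K [0..<e]) \<rho> = mat d d (\<lambda>(i, j). \<Sum>r<e. \<rho> $$ (i * e + r, j * e + r))"
  proof (rule eq_matI)
    fix i j assume "i < dim_row (mat d d (\<lambda>(i, j). \<Sum>r<e. \<rho> $$ (i * e + r, j * e + r)))"
      "j < dim_col (mat d d (\<lambda>(i, j). \<Sum>r<e. \<rho> $$ (i * e + r, j * e + r)))"
    then have ij: "i < d" "j < d" by auto
    have "(K r * \<rho> * dagger (K r)) $$ (i, j) = \<rho> $$ (i * e + r, j * e + r)" if r: "r < e" for r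
    proof -
      have lt: "i * e + r < d * e" "j * e + r < d * e" using ij r by (auto intro: mult_add_less)
      have 1: "(K r * \<rho>) $$ (i, l) = \<rho> $$ (i * e + r, l)" if "l < d * e" for l
      proof -
        have "(K r * \<rho>) $$ (i, l) = (\<Sum>k<d * e. K r $$ (i, k) * \<rho> $$ (k, l))"
          using K \<rho> ij that by (intro mat_mult_index) auto
        also have "\<dots> = (\<Sum>k<d * e. if k = i * e + r then \<rho> $$ (k, l) else 0)"
          using ij by (intro sum.cong) (auto simp: K_def)
        finally show ?thesis using lt by simp
      qed
      have "(K r * \<rho> * dagger (K r)) $$ (i, j) = (\<Sum>l<d * e. (K r * \<rho>) $$ (i, l) * dagger (K r) $$ (l, j))"
        using K[of r] \<rho> ij by (intro mat_mult_index[of _ d _ _ d] mult_carrier_mat[of _ d "d * e"]) auto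
      also have "\<dots> = (\<Sum>l<d * e. if l = j * e + r then \<rho> $$ (i * e + r, l) else 0)"
        using ij 1 K by (intro sum.cong) (auto simp: K_def simp del: index_mult_mat)
      finally show ?thesis using lt by simp
    qed
    then show "apply_channel (d * e) d (map K [0..<e]) \<rho> $$ (i, j) =
        mat d d (\<lambda>(i, j). \<Sum>r<e. \<rho> $$ (i * e + r, j * e + r)) $$ (i, j)"
      unfolding apply_channel_def using K \<rho> ij
      by (subst foldr_add_index) (auto simp del: map_map simp: Ks intro!: kraus_term_carrier[of _ d "d * e"])
  qed (use apply_channel_carrier[OF kc \<rho>] in auto)
qed

section \<open>Permuting tensor factors\<close>

definition perm_mat :: "nat \<Rightarrow> (nat \<Rightarrow> nat) \<Rightarrow> complex mat" where
  "perm_mat n f = mat n n (\<lambda>(k, l). if l = f k then 1 else 0)"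

lemma perm_mat_carrier [simp]: "perm_mat n f \<in> carrier_mat n n"
  by (simp add: perm_mat_def)

lemma perm_mat_vec:
  assumes "x \<in> carrier_vec n" "\<And>k. k < n \<Longrightarrow> f k < n"
  shows "perm_mat n f *\<^sub>v x = vec n (\<lambda>k. x $ f k)"
proof (rule eq_vecI)
  fix k assume "k < dim_vec (vec n (\<lambda>k. x $ f k))"
  then have k: "k < n" by simp
  have "(perm_mat n f *\<^sub>v x) $ k = (\<Sum>l<n. perm_mat n f $$ (k, l) * x $ l)"
    using assms k by (intro mat_vec_index) auto
  also have "\<dots> = (\<Sum>l<n. if l = f k then x $ l else 0)"
    using k by (intro sum.cong) (auto simp: perm_mat_def)
  finally show "(perm_mat n f *\<^sub>v x) $ k = vec n (\<lambda>k. x $ f k) $ k"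
    using assms k by simp
qed (simp add: perm_mat_def)

lemma perm_mat_dagger:
  assumes "\<And>k. k < n \<Longrightarrow> f k < n" "\<And>k. k < n \<Longrightarrow> g k < n"
    "\<And>k. k < n \<Longrightarrow> g (f k) = k" "\<And>k. k < n \<Longrightarrow> f (g k) = k"
  shows "dagger (perm_mat n f) = perm_mat n g"
  by (rule eq_matI) (use assms in \<open>auto simp: perm_mat_def\<close>)

lemma perm_mat_mult:
  assumes "\<And>k. k < n \<Longrightarrow> f k < n" "\<And>k. k < n \<Longrightarrow> g k < n" "\<And>k. k < n \<Longrightarrow> g (f k) = k"
  shows "perm_mat n f * perm_mat n g = 1\<^sub>m n"
proof (rule eq_matI)
  fix k l assume "k < dim_row (1\<^sub>m n)" "l < dim_col (1\<^sub>m n)"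
  then have kl: "k < n" "l < n" by auto
  have "(perm_mat n f * perm_mat n g) $$ (k, l) = (\<Sum>i<n. perm_mat n f $$ (k, i) * perm_mat n g $$ (i, l))"
    using kl by (intro mat_mult_index) auto
  also have "\<dots> = (\<Sum>i<n. if i = f k then (if l = k then 1 else 0) else 0)"
    using kl assms by (intro sum.cong) (auto simp: perm_mat_def)
  finally show "(perm_mat n f * perm_mat n g) $$ (k, l) = 1\<^sub>m n $$ (k, l)"
    using assms kl by simp
qed (auto simp: perm_mat_def)

text \<open>Exchanges the two digits of an index. Since \<open>perm_mat\<close> pulls vectors back
  along its index map, \<open>k\<close> is read in the digit order (q, p) of the swapped product and
  sent to its place in the order (p, q).\<close>

definition swap_index :: "nat \<Rightarrow> nat \<Rightarrow> nat \<Rightarrow> nat" where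
  "swap_index p q k = (k mod p) * q + k div p"

lemma swap_index_less:
  assumes "k < p * q" shows "swap_index p q k < p * q"
  using div_mod_less[of k q p] assms
  by (auto simp: swap_index_def mult.commute[of p q] intro: mult_add_less[of _ p _ q, simplified mult.commute[of p q]])

lemma swap_index_inverse:
  assumes "k < p * q" shows "swap_index q p (swap_index p q k) = k"
  using div_mod_less[of k q p] assms by (auto simp: swap_index_def mult.commute[of p q])

definition swap_mat :: "nat \<Rightarrow> nat \<Rightarrow> complex mat" where
  "swap_mat p q = perm_mat (p * q) (swap_index p q)"

lemma swap_mat_carrier [simp]: "swap_mat p q \<in> carrier_mat (p * q) (p * q)"
  by (simp add: swap_mat_def)

lemma swap_mat_dagger: "dagger (swap_mat p q) = swap_mat q p"
  using swap_index_less[of _ p q] swap_index_less[of _ q p]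
    swap_index_inverse[of _ p q] swap_index_inverse[of _ q p]
  unfolding swap_mat_def by (simp add: perm_mat_dagger mult.commute[of q p])

lemma swap_mat_mult: "swap_mat p q * swap_mat q p = 1\<^sub>m (p * q)"
  using swap_index_less[of _ p q] swap_index_less[of _ q p] swap_index_inverse[of _ p q]
  unfolding swap_mat_def by (simp add: perm_mat_mult mult.commute[of q p])

lemma swap_mat_vec:
  assumes "u \<in> carrier_vec p" "v \<in> carrier_vec q"
  shows "swap_mat p q *\<^sub>v kron_vec u v = kron_vec v u"
proof -
  have "swap_mat p q *\<^sub>v kron_vec u v = vec (p * q) (\<lambda>k. kron_vec u v $ swap_index p q k)"
    using assms swap_index_less[of _ p q] unfolding swap_mat_def by (intro perm_mat_vec) auto
  also have "\<dots> = kron_vec v u"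
  proof (rule eq_vecI)
    fix k assume "k < dim_vec (kron_vec v u)"
    then have k: "k < q * p" using assms by simp
    then show "vec (p * q) (\<lambda>k. kron_vec u v $ swap_index p q k) $ k = kron_vec v u $ k"
      using assms div_mod_less[OF k] unfolding swap_index_def
      by (simp add: kron_vec_index mult.commute[of p q]) (simp add: kron_vec_def)
  qed (use assms in auto)
  finally show ?thesis .
qed

section \<open>Isometries and the reordering of copies\<close>

lemma isometry_mult:
  assumes "A \<in> carrier_mat n m" "B \<in> carrier_mat m l" "dagger A * A = 1\<^sub>m m" "dagger B * B = 1\<^sub>m l"
  shows "dagger (A * B) * (A * B) = 1\<^sub>m l"
proof -
  note c = assms(1,2) dagger_carrier[OF assms(1)] dagger_carrier[OF assms(2)]
  have "dagger (A * B) * (A * B) = dagger B * (dagger A * A * B)"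
    using c by (simp add: dagger_mult[of A n m B l] assoc_mult_mat[of _ l m _ n _ l] assoc_mult_mat[of _ m n _ m _ l])
  then show ?thesis using assms by simp
qed

lemma isometry_kron:
  assumes "A \<in> carrier_mat n m" "B \<in> carrier_mat k l" "dagger A * A = 1\<^sub>m m" "dagger B * B = 1\<^sub>m l"
  shows "dagger (kron_mat A B) * kron_mat A B = 1\<^sub>m (m * l)"
  using assms dagger_carrier[OF assms(1)] dagger_carrier[OF assms(2)]
  by (simp add: kron_mat_dagger kron_mat_mult[of _ m n _ l k _ m _ l] kron_mat_one)

text \<open>The copies arrive as all of one state followed by all of the other, but each step
  consumes one of each. In the induction \<open>?M\<close> carries the new \<open>v\<close> past the
  \<open>m\<close> copies of \<open>u\<close>, so that it stands next to the new \<open>u\<close>;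
  the remaining copies are then interleaved by \<open>W\<close>. One \<open>W\<close> serves all
  \<open>u\<close> and \<open>v\<close>, as required for unknown states.\<close>

lemma interleave_isometry:
  "\<exists>W \<in> carrier_mat ((d * d) ^ m) (d ^ m * d ^ m). dagger W * W = 1\<^sub>m (d ^ m * d ^ m) \<and>
     (\<forall>u \<in> carrier_vec d. \<forall>v \<in> carrier_vec d.
        W *\<^sub>v kron_vec (tpow m u) (tpow m v) = tpow m (kron_vec u v))"
proof (induction m)
  case 0
  have "1\<^sub>m 1 *\<^sub>v kron_vec (vec 1 (\<lambda>_. 1)) (vec 1 (\<lambda>_. 1)) = (vec 1 (\<lambda>_. 1) :: complex vec)"
    by (rule eq_vecI) (auto simp: kron_vec_def)
  then show ?case by (intro bexI[of _ "1\<^sub>m 1"]) auto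
next
  case (Suc m)
  define D where "D = d ^ m"
  from Suc obtain W where W: "W \<in> carrier_mat ((d * d) ^ m) (D * D)" "dagger W * W = 1\<^sub>m (D * D)"
    "\<And>u v. u \<in> carrier_vec d \<Longrightarrow> v \<in> carrier_vec d \<Longrightarrow>
        W *\<^sub>v kron_vec (tpow m u) (tpow m v) = tpow m (kron_vec u v)"
    unfolding D_def by blast
  let ?M = "kron_mat (1\<^sub>m d) (kron_mat (swap_mat D d) (1\<^sub>m D))"
  let ?N = "kron_mat (1\<^sub>m (d * d)) W"
  have M0: "?M \<in> carrier_mat (d * (D * d * D)) (d * (D * d * D))"
    by (intro kron_mat_carrier) auto
  have dims: "d * (D * d * D) = d * D * (d * D)" "d * d * (D * D) = d * D * (d * D)"
    by (auto simp: ac_simps)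
  have M: "?M \<in> carrier_mat (d * D * (d * D)) (d * D * (d * D))"
    using M0 unfolding dims .
  have "dagger ?M * ?M = 1\<^sub>m (d * (D * d * D))"
    by (intro isometry_kron[of _ d d _ "D * d * D"] isometry_kron[of _ "D * d" _ _ D])
      (auto simp: swap_mat_dagger swap_mat_mult mult.commute[of d D] intro!: kron_mat_carrier)
  then have M_iso: "dagger ?M * ?M = 1\<^sub>m (d * D * (d * D))" unfolding dims .
  have N: "?N \<in> carrier_mat (d * d * (d * d) ^ m) (d * D * (d * D))"
    using kron_mat_carrier[OF one_carrier_mat W(1), of "d * d"] unfolding dims .
  have "dagger ?N * ?N = 1\<^sub>m (d * d * (D * D))"
    using W by (intro isometry_kron[of _ "d * d"]) auto
  then have N_iso: "dagger ?N * ?N = 1\<^sub>m (d * D * (d * D))" unfolding dims .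
  have "(?N * ?M) *\<^sub>v kron_vec (tpow (Suc m) u) (tpow (Suc m) v) = tpow (Suc m) (kron_vec u v)"
    if u: "u \<in> carrier_vec d" and v: "v \<in> carrier_vec d" for u v
  proof -
    let ?U = "tpow m u" and ?V = "tpow m v"
    have U: "?U \<in> carrier_vec D" and V: "?V \<in> carrier_vec D" using u v by (auto simp: D_def)
    have "?M *\<^sub>v kron_vec (tpow (Suc m) u) (tpow (Suc m) v) =
        ?M *\<^sub>v kron_vec u (kron_vec (kron_vec ?U v) ?V)"
      by (simp add: kron_vec_assoc)
    also have "\<dots> = kron_vec u (kron_vec (kron_vec v ?U) ?V)"
      using u v U V
      by (simp add: kron_mat_vec[of _ d d _ "D * d * D" "D * d * D"] kron_mat_vec[of _ "D * d" "D * d" _ D D]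
          swap_mat_vec)
    also have "\<dots> = kron_vec (kron_vec u v) (kron_vec ?U ?V)"
      by (simp add: kron_vec_assoc)
    finally have "?N *\<^sub>v (?M *\<^sub>v kron_vec (tpow (Suc m) u) (tpow (Suc m) v)) =
        kron_vec (kron_vec u v) (W *\<^sub>v kron_vec ?U ?V)"
      using u v U V W(1) kron_mat_vec[of "1\<^sub>m (d * d)" "d * d" "d * d" W "(d * d) ^ m" "D * D" "kron_vec u v" "kron_vec ?U ?V"]
      by simp
    moreover have "kron_vec (tpow (Suc m) u) (tpow (Suc m) v) \<in> carrier_vec (d * D * (d * D))"
      using u v U V by auto
    ultimately show ?thesis
      using W(3)[OF u v] by (simp add: assoc_mult_mat_vec[OF N M])
  qed
  moreover have "dagger (?N * ?M) * (?N * ?M) = 1\<^sub>m (d * D * (d * D))"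
    using isometry_mult[OF N M N_iso M_iso] .
  moreover have "?N * ?M \<in> carrier_mat (d * d * (d * d) ^ m) (d * D * (d * D))"
    using N M by (rule mult_carrier_mat)
  ultimately show ?case
    by (intro bexI[of _ "?N * ?M"]) (auto simp: D_def)
qed

section \<open>The elementary rotation step\<close>

lemma smult_mult_mat_vec:
  fixes A :: "complex mat"
  assumes "A \<in> carrier_mat n m" "v \<in> carrier_vec m"
  shows "(c \<cdot>\<^sub>m A) *\<^sub>v v = c \<cdot>\<^sub>v (A *\<^sub>v v)"
  using assms by (intro eq_vecI) (auto simp: scalar_prod_def sum_distrib_left mult.assoc)

lemma affine_mult:
  fixes A B :: "complex mat"
  assumes "A \<in> carrier_mat n n" "B \<in> carrier_mat n n" "A * B = 1\<^sub>m n"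
  shows "(a \<cdot>\<^sub>m 1\<^sub>m n + b \<cdot>\<^sub>m A) * (a \<cdot>\<^sub>m 1\<^sub>m n + b \<cdot>\<^sub>m B) =
    (a * a + b * b) \<cdot>\<^sub>m 1\<^sub>m n + (a * b) \<cdot>\<^sub>m (A + B)"
proof -
  have "(a \<cdot>\<^sub>m 1\<^sub>m n + b \<cdot>\<^sub>m A) * (a \<cdot>\<^sub>m 1\<^sub>m n + b \<cdot>\<^sub>m B) =
     a \<cdot>\<^sub>m (a \<cdot>\<^sub>m 1\<^sub>m n + b \<cdot>\<^sub>m A) + b \<cdot>\<^sub>m (a \<cdot>\<^sub>m B + b \<cdot>\<^sub>m 1\<^sub>m n)"
    using assms
    by (simp add: add_mult_distrib_mat[of _ n n _ _ n] mult_add_distrib_mat[of _ n n _ n]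
        mult_smult_distrib[of _ n n _ n] mult_smult_assoc_mat[of _ n n _ n])
  also have "\<dots> = (a * a + b * b) \<cdot>\<^sub>m 1\<^sub>m n + (a * b) \<cdot>\<^sub>m (A + B)"
    using assms(1,2) by (intro eq_matI) (auto simp: algebra_simps)
  finally show ?thesis .
qed

text \<open>The opposite signs cancel the cross terms \<open>\<alpha> * \<beta>\<close> times P + Q
  in the completeness relation and leave 2 (\<alpha>^2 + \<beta>^2). In the output the cross terms
  do not cancel: they form the commutator of P - Q with the input, which is the rotation
  wanted.\<close>

lemma kraus_channel_unitary_pair:
  fixes \<alpha> \<beta> :: real
  assumes "P \<in> carrier_mat n n" "Q \<in> carrier_mat n n" "dagger P = Q" "P * Q = 1\<^sub>m n" "Q * P = 1\<^sub>m n"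
    and "\<alpha>\<^sup>2 + \<beta>\<^sup>2 = 1 / 2"
  shows "kraus_channel n n [\<alpha> \<cdot>\<^sub>m 1\<^sub>m n + \<beta> \<cdot>\<^sub>m P, \<alpha> \<cdot>\<^sub>m 1\<^sub>m n + (- \<beta>) \<cdot>\<^sub>m Q]"
proof -
  have dQ: "dagger Q = P" using assms(3) dagger_dagger[of P] by simp
  have "dagger (\<alpha> \<cdot>\<^sub>m 1\<^sub>m n + \<beta> \<cdot>\<^sub>m P) = complex_of_real \<alpha> \<cdot>\<^sub>m 1\<^sub>m n + complex_of_real \<beta> \<cdot>\<^sub>m Q"
    "dagger (\<alpha> \<cdot>\<^sub>m 1\<^sub>m n + (- \<beta>) \<cdot>\<^sub>m Q) = complex_of_real \<alpha> \<cdot>\<^sub>m 1\<^sub>m n + (- complex_of_real \<beta>) \<cdot>\<^sub>m P"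
    using assms(1-3) dQ by (simp_all add: dagger_add[of _ n n] dagger_smult)
  moreover have "complex_of_real \<alpha> * complex_of_real \<alpha> + complex_of_real \<beta> * complex_of_real \<beta> = 1 / 2"
    using arg_cong[OF assms(6), of complex_of_real] by (simp add: power2_eq_square)
  ultimately show ?thesis
    using assms(1,2,4,5) unfolding kraus_channel_def
    by (auto simp: affine_mult algebra_simps intro!: eq_matI)
qed

text \<open>Here \<open>r\<close> runs over the discarded registers, so tracing them out leaves
  inner products as scalar coefficients of the kept register.\<close>

lemma sum_sesquilinear:
  assumes "w \<in> carrier_vec e" "s \<in> carrier_vec e" "t \<in> carrier_vec e"
  shows "(\<Sum>r<e. (a * w $ r + b * s $ r) * cnj (a' * w $ r + b' * t $ r)) =
    a * cnj a' * cinner w w + b * cnj b' * cinner t s + a * cnj b' * cinner t w + b * cnj a' * cinner w s"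
  using assms
  by (simp add: cinner_eq_sum[of _ e] algebra_simps sum.distrib sum_distrib_left)

text \<open>Outer products with two different vectors span all matrices, so the formula fixes the
  channel by linearity, and on them the input has rank one. The \<alpha> \<beta> term is the double
  commutator of the overview applied to \<open>outer x y\<close>, with each product of projectors
  contracted to inner products; the factor \<open>cinner y x\<close> is the trace of the
  input.\<close>

lemma step_channel:
  fixes \<alpha> \<beta> :: real
  assumes "\<alpha>\<^sup>2 + \<beta>\<^sup>2 = 1 / 2"
  obtains Ks where "kraus_channel (d * (d * d)) d Ks"
    "\<And>x y u v. x \<in> carrier_vec d \<Longrightarrow> y \<in> carrier_vec d \<Longrightarrow> unit_state d u \<Longrightarrow> unit_state d v \<Longrightarrow>
       apply_channel (d * (d * d)) d Ks (kron_mat (outer x y) (proj (kron_vec u v))) =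
       mat d d (\<lambda>(i, j). 2 * \<alpha>\<^sup>2 * (x $ i * cnj (y $ j)) +
         \<beta>\<^sup>2 * cinner y x * (u $ i * cnj (u $ j) + v $ i * cnj (v $ j)) +
         \<alpha> * \<beta> * (cinner u v * (cinner y u * x $ i * cnj (v $ j) - cinner v x * u $ i * cnj (y $ j)) +
           cinner v u * (cinner u x * v $ i * cnj (y $ j) - cinner y v * x $ i * cnj (u $ j))))"
proof -
  define n where "n = d * (d * d)"
  \<comment> \<open>The three-cycle is the swap of the last register with the block of the first
    two: z, u, v becomes v, z, u. Its inverse swaps the first register with the block of the other
    two.\<close>
  define P where "P = swap_mat (d * d) d"
  define Q where "Q = swap_mat d (d * d)"
  define A where "A = \<alpha> \<cdot>\<^sub>m 1\<^sub>m n + \<beta> \<cdot>\<^sub>m P"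
  define B where "B = \<alpha> \<cdot>\<^sub>m 1\<^sub>m n + (- \<beta>) \<cdot>\<^sub>m Q"
  have n': "d * d * d = n" by (simp add: n_def)
  have P: "P \<in> carrier_mat n n" unfolding P_def n'[symmetric] by (rule swap_mat_carrier)
  have Q: "Q \<in> carrier_mat n n" unfolding Q_def n_def by (rule swap_mat_carrier)
  have PQ: "dagger P = Q" "P * Q = 1\<^sub>m n" "Q * P = 1\<^sub>m n"
    unfolding P_def Q_def swap_mat_dagger swap_mat_mult by (auto simp: n_def)
  have AB: "A \<in> carrier_mat n n" "B \<in> carrier_mat n n" using P Q by (auto simp: A_def B_def)
  have pair: "kraus_channel n n [A, B]"
    unfolding A_def B_def using P Q PQ assms by (rule kraus_channel_unitary_pair)
  obtain Ls where Ls: "kraus_channel n d Ls" "\<And>\<rho>. \<rho> \<in> carrier_mat n n \<Longrightarrow>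
      apply_channel n d Ls \<rho> = mat d d (\<lambda>(i, j). \<Sum>r<d * d. \<rho> $$ (i * (d * d) + r, j * (d * d) + r))"
    unfolding n_def using channel_partial_trace by blast
  obtain Ks where Ks: "kraus_channel n d Ks" "\<And>\<rho>. \<rho> \<in> carrier_mat n n \<Longrightarrow>
      apply_channel n d Ks \<rho> = apply_channel n d Ls (apply_channel n n [A, B] \<rho>)"
    using channel_comp[OF pair Ls(1)] by blast
  have act: "(complex_of_real \<alpha> \<cdot>\<^sub>m 1\<^sub>m n + c \<cdot>\<^sub>m R) *\<^sub>v z = \<alpha> \<cdot>\<^sub>v z + c \<cdot>\<^sub>v (R *\<^sub>v z)"
    if "R \<in> carrier_mat n n" "z \<in> carrier_vec n" for c R z
    using that by (simp add: add_mult_distrib_mat_vec[of _ n n] smult_mult_mat_vec[of _ n n])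
  show thesis
  proof
    show "kraus_channel (d * (d * d)) d Ks" using Ks(1) by (simp add: n_def)
    fix x y u v :: "complex vec"
    assume x: "x \<in> carrier_vec d" and y: "y \<in> carrier_vec d" and "unit_state d u" "unit_state d v"
    then have u: "u \<in> carrier_vec d" "cinner u u = 1" and v: "v \<in> carrier_vec d" "cinner v v = 1"
      by (auto simp: unit_state_def)
    define w where "w = kron_vec u v"
    have w: "w \<in> carrier_vec (d * d)" using u v by (simp add: w_def)
    have X: "kron_vec z w \<in> carrier_vec n" if "z \<in> carrier_vec d" for z
      using that w by (simp add: n_def)
    have Az: "A *\<^sub>v kron_vec z w = \<alpha> \<cdot>\<^sub>v kron_vec z w + \<beta> \<cdot>\<^sub>v kron_vec v (kron_vec z u)"
      if z: "z \<in> carrier_vec d" for z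
    proof -
      have "P *\<^sub>v kron_vec z w = kron_vec v (kron_vec z u)"
        unfolding w_def kron_vec_assoc[of z] P_def using z u v by (intro swap_mat_vec) auto
      then show ?thesis unfolding A_def using act[OF P X[OF z]] by simp
    qed
    have Bz: "B *\<^sub>v kron_vec z w = \<alpha> \<cdot>\<^sub>v kron_vec z w + (- \<beta>) \<cdot>\<^sub>v kron_vec u (kron_vec v z)"
      if z: "z \<in> carrier_vec d" for z
    proof -
      have "Q *\<^sub>v kron_vec z w = kron_vec (kron_vec u v) z"
        unfolding w_def Q_def using z u v by (intro swap_mat_vec) auto
      then show ?thesis unfolding B_def using act[OF Q X[OF z], of "- complex_of_real \<beta>"] by (simp add: kron_vec_assoc)
    qed
    define Y where "Y = outer (A *\<^sub>v kron_vec x w) (A *\<^sub>v kron_vec y w) + outer (B *\<^sub>v kron_vec x w) (B *\<^sub>v kron_vec y w)"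
    have Yc: "Y \<in> carrier_mat n n"
      unfolding Y_def using AB X[OF x] X[OF y] by auto
    have "apply_channel n n [A, B] (outer (kron_vec x w) (kron_vec y w)) = Y"
      using conj_outer[OF AB(1,1) X[OF x] X[OF y]] conj_outer[OF AB(2,2) X[OF x] X[OF y]] Yc
        AB X[OF x] X[OF y]
      by (auto simp: apply_channel_def Y_def)
    then have "apply_channel n d Ks (kron_mat (outer x y) (proj w)) =
        mat d d (\<lambda>(i, j). \<Sum>r<d * d. Y $$ (i * (d * d) + r, j * (d * d) + r))"
      using Ks(2) Ls(2)[OF Yc] x y w X by (simp add: proj_eq_outer outer_kron[of _ d _ d])
    also have "\<dots> = mat d d (\<lambda>(i, j). 2 * \<alpha>\<^sup>2 * (x $ i * cnj (y $ j)) +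
         \<beta>\<^sup>2 * cinner y x * (u $ i * cnj (u $ j) + v $ i * cnj (v $ j)) +
         \<alpha> * \<beta> * (cinner u v * (cinner y u * x $ i * cnj (v $ j) - cinner v x * u $ i * cnj (y $ j)) +
           cinner v u * (cinner u x * v $ i * cnj (y $ j) - cinner y v * x $ i * cnj (u $ j))))"
    proof (rule eq_matI)
      fix i j assume "i < dim_row (mat d d (\<lambda>(i, j). 2 * \<alpha>\<^sup>2 * (x $ i * cnj (y $ j)) +
         \<beta>\<^sup>2 * cinner y x * (u $ i * cnj (u $ j) + v $ i * cnj (v $ j)) +
         \<alpha> * \<beta> * (cinner u v * (cinner y u * x $ i * cnj (v $ j) - cinner v x * u $ i * cnj (y $ j)) +
           cinner v u * (cinner u x * v $ i * cnj (y $ j) - cinner y v * x $ i * cnj (u $ j)))))"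
        "j < dim_col (mat d d (\<lambda>(i, j). 2 * \<alpha>\<^sup>2 * (x $ i * cnj (y $ j)) +
         \<beta>\<^sup>2 * cinner y x * (u $ i * cnj (u $ j) + v $ i * cnj (v $ j)) +
         \<alpha> * \<beta> * (cinner u v * (cinner y u * x $ i * cnj (v $ j) - cinner v x * u $ i * cnj (y $ j)) +
           cinner v u * (cinner u x * v $ i * cnj (y $ j) - cinner y v * x $ i * cnj (u $ j)))))"
      then have ij: "i < d" "j < d" by auto
      have e: "k * (d * d) + r < n" if "k < d" "r < d * d" for k r
        unfolding n_def using that by (rule mult_add_less)
      have "(\<Sum>r<d * d. Y $$ (i * (d * d) + r, j * (d * d) + r)) =
        (\<Sum>r<d * d. (\<alpha> * x $ i * w $ r + \<beta> * v $ i * kron_vec x u $ r) *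
            cnj (\<alpha> * y $ j * w $ r + \<beta> * v $ j * kron_vec y u $ r)) +
        (\<Sum>r<d * d. (\<alpha> * x $ i * w $ r + (- \<beta>) * u $ i * kron_vec v x $ r) *
            cnj (\<alpha> * y $ j * w $ r + (- \<beta>) * u $ j * kron_vec v y $ r))"
        unfolding sum.distrib[symmetric]
      proof (intro sum.cong refl)
        fix r assume "r \<in> {..<d * d}"
        then have r: "r < d * d" by simp
        show "Y $$ (i * (d * d) + r, j * (d * d) + r) =
          (\<alpha> * x $ i * w $ r + \<beta> * v $ i * kron_vec x u $ r) *
            cnj (\<alpha> * y $ j * w $ r + \<beta> * v $ j * kron_vec y u $ r) +
          (\<alpha> * x $ i * w $ r + (- \<beta>) * u $ i * kron_vec v x $ r) *
            cnj (\<alpha> * y $ j * w $ r + (- \<beta>) * u $ j * kron_vec v y $ r)"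
          unfolding Y_def Az[OF x] Az[OF y] Bz[OF x] Bz[OF y] outer_def
          using x y u(1) v(1) w ij r e[OF ij(1) r] e[OF ij(2) r]
          by (simp add: kron_vec_index[of _ "d * d"] n_def mult.assoc)
      qed
      also have "\<dots> = 2 * \<alpha>\<^sup>2 * (x $ i * cnj (y $ j)) +
         \<beta>\<^sup>2 * cinner y x * (u $ i * cnj (u $ j) + v $ i * cnj (v $ j)) +
         \<alpha> * \<beta> * (cinner u v * (cinner y u * x $ i * cnj (v $ j) - cinner v x * u $ i * cnj (y $ j)) +
           cinner v u * (cinner u x * v $ i * cnj (y $ j) - cinner y v * x $ i * cnj (u $ j)))"
        unfolding w_def using x y u v
        by (subst (1 2) sum_sesquilinear, simp_all add: cinner_kron[of _ d _ _ d])
          (simp add: algebra_simps power2_eq_square)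
      finally show "mat d d (\<lambda>(i, j). \<Sum>r<d * d. Y $$ (i * (d * d) + r, j * (d * d) + r)) $$ (i, j) =
        mat d d (\<lambda>(i, j). 2 * \<alpha>\<^sup>2 * (x $ i * cnj (y $ j)) +
         \<beta>\<^sup>2 * cinner y x * (u $ i * cnj (u $ j) + v $ i * cnj (v $ j)) +
         \<alpha> * \<beta> * (cinner u v * (cinner y u * x $ i * cnj (v $ j) - cinner v x * u $ i * cnj (y $ j)) +
           cinner v u * (cinner u x * v $ i * cnj (y $ j) - cinner y v * x $ i * cnj (u $ j)))) $$ (i, j)"
        using ij by simp
    qed simp_all
    finally show "apply_channel (d * (d * d)) d Ks (kron_mat (outer x y) (proj (kron_vec u v))) =
       mat d d (\<lambda>(i, j). 2 * \<alpha>\<^sup>2 * (x $ i * cnj (y $ j)) +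
         \<beta>\<^sup>2 * cinner y x * (u $ i * cnj (u $ j) + v $ i * cnj (v $ j)) +
         \<alpha> * \<beta> * (cinner u v * (cinner y u * x $ i * cnj (v $ j) - cinner v x * u $ i * cnj (y $ j)) +
           cinner v u * (cinner u x * v $ i * cnj (y $ j) - cinner y v * x $ i * cnj (u $ j))))"
      by (simp add: n_def w_def)
  qed
qed

section \<open>Iterating the step\<close>

lemma proj_kron:
  assumes "u \<in> carrier_vec n" "v \<in> carrier_vec m"
  shows "proj (kron_vec u v) = kron_mat (proj u) (proj v)"
  using assms by (simp add: proj_eq_outer outer_kron[of _ n _ n _ m _ m])

lemma proj_carrier [simp]: "v \<in> carrier_vec n \<Longrightarrow> proj v \<in> carrier_mat n n"
  by (simp add: proj_eq_outer)

lemma kraus_channel_id: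
  "kraus_channel n n [1\<^sub>m n]" "\<rho> \<in> carrier_mat n n \<Longrightarrow> apply_channel n n [1\<^sub>m n] \<rho> = \<rho>"
  using kraus_channel_isometry[of "1\<^sub>m n" n n] by auto

text \<open>The innermost step uses the front copy of \<open>w\<close>, by
  \<open>channel_tensor_id\<close>, and the channel for \<open>n\<close> copies then runs on its
  output; hence \<open>funpow\<close> is unfolded from the right. The channel is chosen before
  \<open>\<sigma>\<close> and \<open>w\<close>.\<close>

lemma iterated_channel:
  assumes S: "kraus_channel (d * e) d Ss"
  shows "\<exists>Ks. kraus_channel (d * e ^ n) d Ks \<and>
    (\<forall>\<sigma> \<in> carrier_mat d d. \<forall>w \<in> carrier_vec e.
       apply_channel (d * e ^ n) d Ks (kron_mat \<sigma> (proj (tpow n w))) =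
       ((\<lambda>\<tau>. apply_channel (d * e) d Ss (kron_mat \<tau> (proj w))) ^^ n) \<sigma>)"
proof (induction n)
  case 0
  have "kron_mat \<sigma> (proj (vec 1 (\<lambda>_. 1))) = \<sigma>" for \<sigma>
    by (rule eq_matI) (auto simp: kron_mat_def proj_def)
  then show ?case
    using kraus_channel_id(1)[of d] kraus_channel_id(2)[of _ d] by (intro exI[of _ "[1\<^sub>m d]"]) auto
next
  case (Suc n)
  then obtain Ks where Ks: "kraus_channel (d * e ^ n) d Ks"
    "\<And>\<sigma> w. \<sigma> \<in> carrier_mat d d \<Longrightarrow> w \<in> carrier_vec e \<Longrightarrow>
       apply_channel (d * e ^ n) d Ks (kron_mat \<sigma> (proj (tpow n w))) =
       ((\<lambda>\<tau>. apply_channel (d * e) d Ss (kron_mat \<tau> (proj w))) ^^ n) \<sigma>"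
    by blast
  obtain Ts where Ts: "kraus_channel (d * e * e ^ n) (d * e ^ n) Ts"
    "\<And>A B. A \<in> carrier_mat (d * e) (d * e) \<Longrightarrow> B \<in> carrier_mat (e ^ n) (e ^ n) \<Longrightarrow>
      apply_channel (d * e * e ^ n) (d * e ^ n) Ts (kron_mat A B) = kron_mat (apply_channel (d * e) d Ss A) B"
    using channel_tensor_id[OF S] by blast
  obtain Ms where Ms: "kraus_channel (d * e * e ^ n) d Ms"
    "\<And>\<rho>. \<rho> \<in> carrier_mat (d * e * e ^ n) (d * e * e ^ n) \<Longrightarrow>
      apply_channel (d * e * e ^ n) d Ms \<rho> =
      apply_channel (d * e ^ n) d Ks (apply_channel (d * e * e ^ n) (d * e ^ n) Ts \<rho>)"
    using channel_comp[OF Ts(1) Ks(1)] by blast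
  have "apply_channel (d * e * e ^ n) d Ms (kron_mat \<sigma> (proj (tpow (Suc n) w))) =
       ((\<lambda>\<tau>. apply_channel (d * e) d Ss (kron_mat \<tau> (proj w))) ^^ Suc n) \<sigma>"
    if \<sigma>: "\<sigma> \<in> carrier_mat d d" and w: "w \<in> carrier_vec e" for \<sigma> w
  proof -
    have c: "kron_mat \<sigma> (proj w) \<in> carrier_mat (d * e) (d * e)"
      "proj (tpow n w) \<in> carrier_mat (e ^ n) (e ^ n)" using \<sigma> w by auto
    have "kron_mat \<sigma> (proj (tpow (Suc n) w)) = kron_mat (kron_mat \<sigma> (proj w)) (proj (tpow n w))"
      using w by (simp add: proj_kron[of _ e _ "e ^ n"] kron_mat_assoc)
    then show ?thesis
      using Ms(2)[OF kron_mat_carrier[OF c]] Ts(2)[OF c]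
        Ks(2)[OF apply_channel_carrier[OF S c(1)] w]
      by (simp add: funpow_Suc_right del: funpow.simps)
  qed
  with Ms(1) show ?case
    by (intro exI[of _ Ms]) (simp add: mult.assoc)
qed

text \<open>Of the \<open>Suc n\<close> pairs one supplies the starting state \<open>u\<close>, its
  partner \<open>v\<close> being traced out, and the other \<open>n\<close> drive the steps. After
  interleaving, that pair is simply the front one.\<close>

lemma simulation_channel:
  assumes S: "kraus_channel (d * (d * d)) d Ss"
  shows "\<exists>Ks. kraus_channel (d ^ Suc n * d ^ Suc n) d Ks \<and>
    (\<forall>u v. unit_state d u \<and> unit_state d v \<longrightarrow>
       apply_channel (d ^ Suc n * d ^ Suc n) d Ks (proj (kron_vec (tpow (Suc n) u) (tpow (Suc n) v))) =
       ((\<lambda>\<tau>. apply_channel (d * (d * d)) d Ss (kron_mat \<tau> (proj (kron_vec u v)))) ^^ n) (proj u))"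
proof -
  define N where "N = d ^ Suc n * d ^ Suc n"
  define E where "E = (d * d) ^ n"
  obtain W where W: "W \<in> carrier_mat (d * d * E) N" "dagger W * W = 1\<^sub>m N"
    "\<And>u v. u \<in> carrier_vec d \<Longrightarrow> v \<in> carrier_vec d \<Longrightarrow>
        W *\<^sub>v kron_vec (tpow (Suc n) u) (tpow (Suc n) v) = tpow (Suc n) (kron_vec u v)"
    using interleave_isometry[of d "Suc n"] unfolding N_def E_def power_Suc[of "d * d"] by blast
  obtain Ps where Ps: "kraus_channel (d * d) d Ps" "\<And>\<rho>. \<rho> \<in> carrier_mat (d * d) (d * d) \<Longrightarrow>
      apply_channel (d * d) d Ps \<rho> = mat d d (\<lambda>(i, j). \<Sum>r<d. \<rho> $$ (i * d + r, j * d + r))"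
    using channel_partial_trace by blast
  obtain Ts where Ts: "kraus_channel (d * d * E) (d * E) Ts"
    "\<And>A B. A \<in> carrier_mat (d * d) (d * d) \<Longrightarrow> B \<in> carrier_mat E E \<Longrightarrow>
      apply_channel (d * d * E) (d * E) Ts (kron_mat A B) = kron_mat (apply_channel (d * d) d Ps A) B"
    using channel_tensor_id[OF Ps(1)] by blast
  obtain Is where Is: "kraus_channel (d * E) d Is"
    "\<And>\<sigma> w. \<sigma> \<in> carrier_mat d d \<Longrightarrow> w \<in> carrier_vec (d * d) \<Longrightarrow>
       apply_channel (d * E) d Is (kron_mat \<sigma> (proj (tpow n w))) =
       ((\<lambda>\<tau>. apply_channel (d * (d * d)) d Ss (kron_mat \<tau> (proj w))) ^^ n) \<sigma>"
    using iterated_channel[OF S, of n] unfolding E_def by blast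
  obtain Ls where Ls: "kraus_channel N (d * E) Ls" "\<And>\<rho>. \<rho> \<in> carrier_mat N N \<Longrightarrow>
      apply_channel N (d * E) Ls \<rho> = apply_channel (d * d * E) (d * E) Ts (apply_channel N (d * d * E) [W] \<rho>)"
    using channel_comp[OF kraus_channel_isometry(1)[OF W(1,2)] Ts(1)] by blast
  obtain Ks where Ks: "kraus_channel N d Ks" "\<And>\<rho>. \<rho> \<in> carrier_mat N N \<Longrightarrow>
      apply_channel N d Ks \<rho> = apply_channel (d * E) d Is (apply_channel N (d * E) Ls \<rho>)"
    using channel_comp[OF Ls(1) Is(1)] by blast
  have "apply_channel N d Ks (proj (kron_vec (tpow (Suc n) u) (tpow (Suc n) v))) =
       ((\<lambda>\<tau>. apply_channel (d * (d * d)) d Ss (kron_mat \<tau> (proj (kron_vec u v)))) ^^ n) (proj u)"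
    if "unit_state d u" "unit_state d v" for u v
  proof -
    from that have u: "u \<in> carrier_vec d" and v: "v \<in> carrier_vec d" "cinner v v = 1"
      by (auto simp: unit_state_def)
    define x where "x = kron_vec (tpow (Suc n) u) (tpow (Suc n) v)"
    define w where "w = kron_vec u v"
    have w: "w \<in> carrier_vec (d * d)" using u v by (simp add: w_def)
    have wn: "tpow n w \<in> carrier_vec E" using w by (simp add: E_def)
    have x: "x \<in> carrier_vec N"
      unfolding x_def N_def using u v by (intro kron_vec_carrier tpow_carrier)
    have "apply_channel N (d * d * E) [W] (proj x) = proj (W *\<^sub>v x)"
      using kraus_channel_isometry(2)[OF W(1,2)] conj_outer[OF W(1,1) x x] x
      by (simp add: proj_eq_outer)
    also have "W *\<^sub>v x = kron_vec w (tpow n w)"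
      using W(3)[OF u v(1)] by (simp add: x_def w_def)
    also have "proj \<dots> = kron_mat (proj w) (proj (tpow n w))"
      using w wn by (rule proj_kron)
    finally have 1: "apply_channel N (d * E) Ls (proj x) = kron_mat (apply_channel (d * d) d Ps (proj w)) (proj (tpow n w))"
      using Ls(2) Ts(2) w wn x by simp
    have "apply_channel (d * d) d Ps (proj w) = proj u"
    proof (rule eq_matI)
      fix i j assume "i < dim_row (proj u)" "j < dim_col (proj u)"
      then have ij: "i < d" "j < d" using u by (auto simp: proj_def)
      have "(\<Sum>r<d. proj w $$ (i * d + r, j * d + r)) = (\<Sum>r<d. u $ i * cnj (u $ j) * (cnj (v $ r) * v $ r))"
        using u v ij by (intro sum.cong refl) (auto simp: proj_def w_def kron_vec_index mult_add_less)
      also have "\<dots> = u $ i * cnj (u $ j)"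
        using v by (simp add: sum_distrib_left[symmetric] cinner_eq_sum[of v d])
      finally show "apply_channel (d * d) d Ps (proj w) $$ (i, j) = proj u $$ (i, j)"
        using Ps(2)[of "proj w"] u w ij by (simp add: proj_def)
    qed (use Ps(2)[of "proj w"] u w in \<open>auto simp: proj_def\<close>)
    then show ?thesis
      using Ks(2)[of "proj x"] 1 Is(2)[of "proj u" w] u w x by (simp add: x_def[symmetric] w_def[symmetric] del: tpow.simps)
  qed
  with Ks(1) show ?thesis unfolding N_def by blast
qed

section \<open>Trace distance in a two-dimensional frame\<close>

text \<open>Uniqueness of the root without a spectral theorem: a positive \<open>B\<close> with
  square l^2 P vanishes on the kernel of \<open>P\<close>, because the squared norm of B v is the
  inner product of v with B (B v), and on the range of \<open>P\<close> positivity excludes the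
  eigenvalue -l.\<close>

lemma psd_sqrt_projection:
  fixes l :: real
  assumes P: "P \<in> carrier_mat n n" "dagger P = P" "P * P = P" and l: "0 \<le> l"
  shows "psd_sqrt ((l\<^sup>2) \<cdot>\<^sub>m P) = l \<cdot>\<^sub>m P"
proof -
  have nonneg: "0 \<le> Re (cinner v v)" if "v \<in> carrier_vec n" for v
    using that by (simp add: cinner_self sum_nonneg)
  have psd_lP: "psd n (l \<cdot>\<^sub>m P)"
    unfolding psd_def
  proof (intro conjI ballI)
    fix v :: "complex vec" assume v: "v \<in> carrier_vec n"
    have Pv: "P *\<^sub>v v \<in> carrier_vec n" using P v by auto
    have "P *\<^sub>v (P *\<^sub>v v) = P *\<^sub>v v" using P v by (simp add: assoc_mult_mat_vec[symmetric, of _ n n _ n])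
    then have "cinner v (P *\<^sub>v v) = cinner (P *\<^sub>v v) (P *\<^sub>v v)"
      using cinner_adjoint[OF P(1) v Pv] P(2) by simp
    then show "0 \<le> Re (cinner v ((complex_of_real l \<cdot>\<^sub>m P) *\<^sub>v v))"
      using nonneg[OF Pv] l P v by (simp add: smult_mult_mat_vec[of _ n n] cinner_smult_right)
  qed (use P in \<open>auto simp: dagger_smult\<close>)
  have sq: "(l \<cdot>\<^sub>m P) * (l \<cdot>\<^sub>m P) = (l\<^sup>2) \<cdot>\<^sub>m P"
    using P by (simp add: mult_smult_distrib[of _ n n _ n] mult_smult_assoc_mat[of _ n n _ n] power2_eq_square)
      (auto intro!: eq_matI)
  have unique: "B = l \<cdot>\<^sub>m P" if B: "psd n B" "B * B = (l\<^sup>2) \<cdot>\<^sub>m P" for B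
  proof -
    have Bc: "B \<in> carrier_mat n n" and Bd: "dagger B = B"
      and Bpos: "\<And>v. v \<in> carrier_vec n \<Longrightarrow> 0 \<le> Re (cinner v (B *\<^sub>v v))"
      using B(1) by (auto simp: psd_def)
    have BB: "B *\<^sub>v (B *\<^sub>v v) = (l\<^sup>2) \<cdot>\<^sub>v (P *\<^sub>v v)" if "v \<in> carrier_vec n" for v
      using assoc_mult_mat_vec[OF Bc Bc that] B(2) P that by (simp add: smult_mult_mat_vec[of _ n n])
    have ker: "B *\<^sub>v v = 0\<^sub>v n" if v: "v \<in> carrier_vec n" and "B *\<^sub>v (B *\<^sub>v v) = 0\<^sub>v n" for v
    proof (rule cinner_self_eq_0)
      show "B *\<^sub>v v \<in> carrier_vec n" using Bc v by auto
      then show "cinner (B *\<^sub>v v) (B *\<^sub>v v) = 0"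
        using cinner_adjoint[OF Bc v, of "B *\<^sub>v v"] Bd that(2) by (simp add: cinner_def)
    qed
    have "B *\<^sub>v v = l \<cdot>\<^sub>v (P *\<^sub>v v)" if v: "v \<in> carrier_vec n" for v
    proof -
      define p where "p = P *\<^sub>v v"
      have p: "p \<in> carrier_vec n" using P v by (auto simp: p_def)
      have Pp: "P *\<^sub>v p = p" using P v by (simp add: p_def assoc_mult_mat_vec[symmetric, of _ n n _ n])
      have vp: "v - p \<in> carrier_vec n" using v p by auto
      have "P *\<^sub>v (v - p) = 0\<^sub>v n"
        using P v p Pp by (simp add: mult_minus_distrib_mat_vec[of _ n n] p_def)
      then have "B *\<^sub>v (B *\<^sub>v (v - p)) = 0\<^sub>v n" using BB[OF vp] by (auto intro!: eq_vecI)
      then have "B *\<^sub>v v - B *\<^sub>v p = 0\<^sub>v n"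
        using ker[OF vp] Bc v p by (simp add: mult_minus_distrib_mat_vec[of _ n n])
      then have "(B *\<^sub>v v) $ i - (B *\<^sub>v p) $ i = 0" if "i < n" for i
        using that Bc v p by (metis carrier_vecD index_minus_vec(1) index_zero_vec(1) mult_mat_vec_carrier)
      then have Bvp: "B *\<^sub>v v = B *\<^sub>v p"
        using Bc v p by (intro eq_vecI) auto
      \<comment> \<open>On the range of \<open>P\<close> the square of \<open>B\<close> is l^2, so
        B^2 - l^2 factors and B p - l p is sent by \<open>B\<close> to -l times itself.\<close>
      define w where "w = B *\<^sub>v p + (- l) \<cdot>\<^sub>v p"
      have Bp: "B *\<^sub>v p \<in> carrier_vec n" using Bc p by auto
      have w: "w \<in> carrier_vec n" using Bp p by (auto simp: w_def)
      have "B *\<^sub>v w = (l\<^sup>2) \<cdot>\<^sub>v p + (- l) \<cdot>\<^sub>v (B *\<^sub>v p)"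
        unfolding w_def using Bc Bp p BB[OF p] Pp
        by (simp add: mult_add_distrib_mat_vec[of _ n n] mult_mat_vec[of _ n n])
      also have "\<dots> = (- l) \<cdot>\<^sub>v w"
        unfolding w_def using Bp p Bc by (intro eq_vecI) (auto simp: right_diff_distrib power2_eq_square)
      finally have "cinner w (B *\<^sub>v w) = - (l * cinner w w)" by (simp add: cinner_smult_right)
      then have "l * Re (cinner w w) \<le> 0" using Bpos[OF w] by simp
      then have "l = 0 \<or> Re (cinner w w) = 0"
        using l nonneg[OF w] by (metis mult_nonneg_nonneg mult_eq_0_iff order_antisym)
      then have "w = 0\<^sub>v n"
      proof
        \<comment> \<open>Positivity says nothing here, but then the square of \<open>B\<close> is
          zero and the kernel argument applies to \<open>p\<close> as well.\<close>
        assume "l = 0"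
        then have "B *\<^sub>v (B *\<^sub>v p) = 0\<^sub>v n" using BB[OF p] p Pp by (auto intro!: eq_vecI)
        then have "B *\<^sub>v p = 0\<^sub>v n" by (rule ker[OF p])
        with \<open>l = 0\<close> show ?thesis using p by (auto simp: w_def intro!: eq_vecI)
      next
        assume "Re (cinner w w) = 0"
        then show ?thesis using cinner_self_eq_0[OF w] by (simp add: cinner_self[OF w])
      qed
      then have "\<And>i. i < n \<Longrightarrow> (B *\<^sub>v p) $ i - l * p $ i = 0"
        using Bp p by (metis (no_types, lifting) w_def add_uminus_conv_diff carrier_vecD index_add_vec(1)
            index_smult_vec index_zero_vec(1) mult_minus_left of_real_minus)
      then show ?thesis unfolding Bvp p_def[symmetric] using Bp p Bc by (intro eq_vecI) auto
    qed
    then have Beq: "B *\<^sub>v v = (l \<cdot>\<^sub>m P) *\<^sub>v v" if "v \<in> carrier_vec n" for v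
      using that P by (simp add: smult_mult_mat_vec[of _ n n])
    have entry: "(A *\<^sub>v unit_vec n j) $ i = A $$ (i, j)"
      if "A \<in> carrier_mat n n" "i < n" "j < n" for A :: "complex mat" and i j
      using that
      by (subst mat_vec_index[of _ n n]) (auto simp: unit_vec_def if_distrib cong: if_cong)
    have lP: "l \<cdot>\<^sub>m P \<in> carrier_mat n n" using P by auto
    show ?thesis
    proof (rule eq_matI)
      fix i j assume "i < dim_row (l \<cdot>\<^sub>m P)" "j < dim_col (l \<cdot>\<^sub>m P)"
      then have "i < n" "j < n" using P by auto
      then show "B $$ (i, j) = (l \<cdot>\<^sub>m P) $$ (i, j)"
        using entry[OF Bc] entry[OF lP] Beq[of "unit_vec n j"] by (metis unit_vec_carrier)
    qed (use Bc P in auto)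
  qed
  have dim: "dim_row ((l\<^sup>2) \<cdot>\<^sub>m P) = n" using P(1) by simp
  show ?thesis
    unfolding psd_sqrt_def dim by (rule the_equality) (use psd_lP sq unique in blast)+
qed

section \<open>Operators supported on a plane\<close>

definition orthonormal_pair :: "nat \<Rightarrow> complex vec \<Rightarrow> complex vec \<Rightarrow> bool" where
  "orthonormal_pair n u v \<longleftrightarrow> unit_state n u \<and> unit_state n v \<and> cinner u v = 0"

lemma orthonormal_pairD:
  assumes "orthonormal_pair n u v"
  shows "u \<in> carrier_vec n" "v \<in> carrier_vec n"
    "cinner u u = 1" "cinner v v = 1" "cinner u v = 0" "cinner v u = 0"
  using assms cinner_commute[of v n u] by (auto simp: orthonormal_pair_def unit_state_def)

text \<open>For an orthonormal pair this is the operator with coefficient rows (a, b) and (c, e) in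
  the frame \<open>u\<close>, \<open>v\<close>, extended by zero; sums, products, adjoints and
  traces are then those of 2 x 2 matrices.\<close>

definition plane_mat :: "complex vec \<Rightarrow> complex vec \<Rightarrow> complex \<Rightarrow> complex \<Rightarrow> complex \<Rightarrow> complex \<Rightarrow> complex mat" where
  "plane_mat u v a b c e = mat (dim_vec u) (dim_vec u) (\<lambda>(i, j).
     a * (u $ i * cnj (u $ j)) + b * (u $ i * cnj (v $ j)) +
     c * (v $ i * cnj (u $ j)) + e * (v $ i * cnj (v $ j)))"

lemma plane_mat_carrier: "u \<in> carrier_vec n \<Longrightarrow> plane_mat u v a b c e \<in> carrier_mat n n"
  by (auto simp: plane_mat_def)

lemma plane_mat_mult:
  assumes "orthonormal_pair n u v"
  shows "plane_mat u v a b c e * plane_mat u v a' b' c' e' =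
    plane_mat u v (a * a' + b * c') (a * b' + b * e') (c * a' + e * c') (c * b' + e * e')"
proof (rule eq_matI)
  note o = orthonormal_pairD[OF assms]
  fix i j assume "i < dim_row (plane_mat u v (a * a' + b * c') (a * b' + b * e') (c * a' + e * c') (c * b' + e * e'))"
    "j < dim_col (plane_mat u v (a * a' + b * c') (a * b' + b * e') (c * a' + e * c') (c * b' + e * e'))"
  then have ij: "i < n" "j < n" using o by (auto simp: plane_mat_def)
  \<comment> \<open>Row \<open>i\<close> of the left factor is p and q times the conjugates of
    \<open>u\<close> and \<open>v\<close>, and column \<open>j\<close> of the right factor is r and
    s times \<open>u\<close> and \<open>v\<close>; the sum over \<open>k\<close> then consists of
    four inner products.\<close>
  define p q r s where "p = a * u $ i + c * v $ i" and "q = b * u $ i + e * v $ i"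
    and "r = a' * cnj (u $ j) + b' * cnj (v $ j)" and "s = c' * cnj (u $ j) + e' * cnj (v $ j)"
  have "(plane_mat u v a b c e * plane_mat u v a' b' c' e') $$ (i, j) =
      (\<Sum>k<n. plane_mat u v a b c e $$ (i, k) * plane_mat u v a' b' c' e' $$ (k, j))"
    using plane_mat_carrier[OF o(1)] plane_mat_carrier[OF o(1)] ij by (rule mat_mult_index)
  also have "\<dots> = (\<Sum>k<n. p * r * (cnj (u $ k) * u $ k) + p * s * (cnj (u $ k) * v $ k)
      + q * r * (cnj (v $ k) * u $ k) + q * s * (cnj (v $ k) * v $ k))"
    using o ij by (intro sum.cong refl) (auto simp: plane_mat_def p_def q_def r_def s_def algebra_simps)
  also have "\<dots> = p * r * cinner u u + p * s * cinner u v + q * r * cinner v u + q * s * cinner v v"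
    using o(1,2) by (simp add: cinner_eq_sum[of _ n] sum.distrib sum_distrib_left)
  also have "\<dots> = plane_mat u v (a * a' + b * c') (a * b' + b * e') (c * a' + e * c') (c * b' + e * e') $$ (i, j)"
    using o ij by (simp add: plane_mat_def p_def q_def r_def s_def algebra_simps)
  finally show "(plane_mat u v a b c e * plane_mat u v a' b' c' e') $$ (i, j) = \<dots>" .
qed (auto simp: plane_mat_def)

lemma plane_mat_dagger: "dagger (plane_mat u v a b c e) = plane_mat u v (cnj a) (cnj c) (cnj b) (cnj e)"
  by (rule eq_matI) (auto simp: plane_mat_def algebra_simps)

lemma plane_mat_diff:
  "plane_mat u v a b c e - plane_mat u v a' b' c' e' = plane_mat u v (a - a') (b - b') (c - c') (e - e')"
  by (rule eq_matI) (auto simp: plane_mat_def algebra_simps)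

lemma plane_mat_smult: "k \<cdot>\<^sub>m plane_mat u v a b c e = plane_mat u v (k * a) (k * b) (k * c) (k * e)"
  by (rule eq_matI) (auto simp: plane_mat_def algebra_simps)

lemma plane_mat_trace:
  assumes "orthonormal_pair n u v"
  shows "mtrace (plane_mat u v a b c e) = a + e"
proof -
  note o = orthonormal_pairD[OF assms]
  have "mtrace (plane_mat u v a b c e) = a * cinner u u + b * cinner v u + c * cinner u v + e * cinner v v"
    using o(1,2) by (simp add: mtrace_def plane_mat_def cinner_eq_sum[of _ n] sum.distrib sum_distrib_left mult_ac)
  with o show ?thesis by simp
qed

text \<open>The real density matrices of the plane spanned by u and v, parametrised by their Bloch
  vector read as a complex number: the pure state at angle t has parameter cis (2 t).\<close>

definition bloch :: "complex vec \<Rightarrow> complex vec \<Rightarrow> complex \<Rightarrow> complex mat" where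
  "bloch u v z = plane_mat u v ((1 + Re z) / 2) (Im z / 2) (Im z / 2) ((1 - Re z) / 2)"

lemma bloch_carrier: "u \<in> carrier_vec n \<Longrightarrow> bloch u v z \<in> carrier_mat n n"
  by (simp add: bloch_def plane_mat_carrier)

text \<open>The difference has coefficient rows (x, y) and (y, -x), whose square is x^2 + y^2 times
  the identity of the plane. Its absolute value is therefore \<open>l\<close> times the projection
  onto the plane, which has trace 2.\<close>

lemma trace_dist_bloch:
  assumes o: "orthonormal_pair n u v"
  shows "trace_dist (bloch u v z) (bloch u v z') = cmod (z - z') / 2"
proof -
  define x y where "x = Re (z - z') / 2" and "y = Im (z - z') / 2"
  define l where "l = cmod (z - z') / 2"
  have l2: "complex_of_real x * complex_of_real x + complex_of_real y * complex_of_real y = (complex_of_real l)\<^sup>2"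
    unfolding of_real_power[symmetric] of_real_mult[symmetric] of_real_add[symmetric] of_real_eq_iff
    using cmod_power2[of "z - z'"] by (simp add: x_def y_def l_def power_divide power2_eq_square)
  let ?P = "plane_mat u v 1 0 0 1"
  have "bloch u v z - bloch u v z' = plane_mat u v x y y (- x)"
    by (simp add: bloch_def plane_mat_diff x_def y_def diff_divide_distrib add_divide_distrib)
  then have "(bloch u v z - bloch u v z') * dagger (bloch u v z - bloch u v z') = (l\<^sup>2) \<cdot>\<^sub>m ?P"
    using l2 by (simp add: plane_mat_dagger plane_mat_mult[OF o] plane_mat_smult add.commute)
  moreover have "psd_sqrt ((l\<^sup>2) \<cdot>\<^sub>m ?P) = l \<cdot>\<^sub>m ?P"
    using orthonormal_pairD(1)[OF o]
    by (intro psd_sqrt_projection[of _ n])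
      (auto simp: plane_mat_carrier plane_mat_dagger plane_mat_mult[OF o] l_def)
  ultimately show ?thesis
    by (simp add: trace_dist_def trace_norm_def plane_mat_smult plane_mat_trace[OF o] l_def)
qed

text \<open>With the second state c u + s v the commutator of the two projectors is c s times the
  difference of \<open>outer u v\<close> and \<open>outer v u\<close>; Bloch angles are doubled,
  which explains the factor 2 in the imaginary part. The Bloch parameters of the two projectors are
  1 and the square of c + i s. Using \<open>c\<close> and \<open>s\<close> instead of an angle keeps
  everything polynomial.\<close>

lemma step_bloch:
  fixes \<alpha> \<beta> :: real
  assumes "\<alpha>\<^sup>2 + \<beta>\<^sup>2 = 1 / 2"
  obtains Ks where "kraus_channel (d * (d * d)) d Ks"
    "\<And>u v c s z. orthonormal_pair d u v \<Longrightarrow> c\<^sup>2 + s\<^sup>2 = 1 \<Longrightarrow>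
       apply_channel (d * (d * d)) d Ks
         (kron_mat (bloch u v z) (proj (kron_vec u (complex_of_real c \<cdot>\<^sub>v u + complex_of_real s \<cdot>\<^sub>v v)))) =
       bloch u v (Complex (2 * \<alpha>\<^sup>2) (2 * \<alpha> * \<beta> * c * s) * z + \<beta>\<^sup>2 * (1 + (Complex c s)\<^sup>2))"
proof -
  let ?D = "d * (d * d)"
  obtain Ks where Ks: "kraus_channel ?D d Ks"
    "\<And>x y u v. x \<in> carrier_vec d \<Longrightarrow> y \<in> carrier_vec d \<Longrightarrow> unit_state d u \<Longrightarrow> unit_state d v \<Longrightarrow>
       apply_channel ?D d Ks (kron_mat (outer x y) (proj (kron_vec u v))) =
       mat d d (\<lambda>(i, j). 2 * \<alpha>\<^sup>2 * (x $ i * cnj (y $ j)) +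
         \<beta>\<^sup>2 * cinner y x * (u $ i * cnj (u $ j) + v $ i * cnj (v $ j)) +
         \<alpha> * \<beta> * (cinner u v * (cinner y u * x $ i * cnj (v $ j) - cinner v x * u $ i * cnj (y $ j)) +
           cinner v u * (cinner u x * v $ i * cnj (y $ j) - cinner y v * x $ i * cnj (u $ j))))"
    using step_channel[OF assms] by blast
  have Kc: "\<And>K. K \<in> set Ks \<Longrightarrow> K \<in> carrier_mat d ?D" using Ks(1) by (auto simp: kraus_channel_def)
  have \<alpha>\<beta>: "2 * (complex_of_real \<alpha>)\<^sup>2 = 1 - 2 * (complex_of_real \<beta>)\<^sup>2"
    using arg_cong[OF assms, of "\<lambda>x. complex_of_real (2 * x)"] by (simp add: algebra_simps)
  show thesis
  proof
    show "kraus_channel ?D d Ks" by (rule Ks(1))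
    fix u v :: "complex vec" and c s :: real and z
    assume o': "orthonormal_pair d u v" and cs: "c\<^sup>2 + s\<^sup>2 = 1"
    note o = orthonormal_pairD[OF o']
    define w where "w = complex_of_real c \<cdot>\<^sub>v u + complex_of_real s \<cdot>\<^sub>v v"
    have w: "w \<in> carrier_vec d" using o by (simp add: w_def)
    have uw: "cinner u w = c" "cinner v w = s"
      using o by (simp_all add: w_def cinner_add_right[of _ d] cinner_smult_right)
    have wu: "cinner w u = c" "cinner w v = s"
      using uw cinner_commute[OF w o(1)] cinner_commute[OF w o(2)] by simp_all
    have cs': "(complex_of_real c)\<^sup>2 + (complex_of_real s)\<^sup>2 = 1"
      using arg_cong[OF cs, of complex_of_real] by simp
    have "cinner w w = 1"
      using o wu cs' by (subst (2) w_def) (simp add: cinner_add_right[of _ d] cinner_smult_right power2_eq_square)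
    then have wunit: "unit_state d w" and uunit: "unit_state d u"
      using w o by (auto simp: unit_state_def)
    define R where "R = proj (kron_vec u w)"
    have R: "R \<in> carrier_mat (d * d) (d * d)" using o w by (simp add: R_def)
    note H = Ks(2)[OF _ _ uunit wunit, folded R_def]
    define p q where "p = complex_of_real (Re z)" and "q = complex_of_real (Im z)"
    define F where "F A = apply_channel ?D d Ks (kron_mat A R)" for A
    have F_carrier: "F A \<in> carrier_mat d d" if "A \<in> carrier_mat d d" for A
      unfolding F_def using that R by (intro apply_channel_carrier[OF Ks(1)] kron_mat_carrier)
    have F_add: "F (A + B) = F A + F B" if "A \<in> carrier_mat d d" "B \<in> carrier_mat d d" for A B
      unfolding F_def using that R
      by (simp add: kron_mat_add_left[of _ d d _ _ "d * d" "d * d"] apply_channel_add[OF Kc])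
    have F_smult: "F (k \<cdot>\<^sub>m A) = k \<cdot>\<^sub>m F A" if "A \<in> carrier_mat d d" for A k
      unfolding F_def using that R by (simp add: kron_mat_smult_left apply_channel_smult[OF Kc])
    have oc: "outer u u \<in> carrier_mat d d" "outer u v \<in> carrier_mat d d"
      "outer v u \<in> carrier_mat d d" "outer v v \<in> carrier_mat d d" using o by auto
    have "bloch u v z = ((1 + p) / 2) \<cdot>\<^sub>m outer u u + ((q / 2) \<cdot>\<^sub>m outer u v +
        ((q / 2) \<cdot>\<^sub>m outer v u + ((1 - p) / 2) \<cdot>\<^sub>m outer v v))"
      using o(1,2) by (intro eq_matI) (auto simp: bloch_def plane_mat_def outer_def p_def q_def)
    then have Fb: "F (bloch u v z) = ((1 + p) / 2) \<cdot>\<^sub>m F (outer u u) + ((q / 2) \<cdot>\<^sub>m F (outer u v) +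
        ((q / 2) \<cdot>\<^sub>m F (outer v u) + ((1 - p) / 2) \<cdot>\<^sub>m F (outer v v)))"
      using oc by (simp add: F_add F_smult)
    note FH = H[OF o(1) o(1), folded F_def] H[OF o(1) o(2), folded F_def]
      H[OF o(2) o(1), folded F_def] H[OF o(2) o(2), folded F_def]
    define z' where "z' = Complex (2 * \<alpha>\<^sup>2) (2 * \<alpha> * \<beta> * c * s) * z + \<beta>\<^sup>2 * (1 + (Complex c s)\<^sup>2)"
    define \<gamma> where "\<gamma> = complex_of_real \<alpha> * complex_of_real \<beta>"
    define B where "B = (complex_of_real \<beta>)\<^sup>2"
    define C where "C = complex_of_real c"
    define S where "S = complex_of_real s"
    have CS: "C * C + S * S = 1" using cs' by (simp add: C_def S_def power2_eq_square)
    have rz: "complex_of_real (Re z') = (1 - 2 * B) * p - 2 * \<gamma> * C * S * q + B * (1 + C * C - S * S)"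
      "complex_of_real (Im z') = (1 - 2 * B) * q + 2 * \<gamma> * C * S * p + 2 * B * C * S"
      unfolding B_def \<alpha>\<beta>[symmetric]
      by (simp_all add: z'_def p_def q_def \<gamma>_def C_def S_def power2_eq_square algebra_simps)
    have "F (bloch u v z) = bloch u v z'"
    proof (rule eq_matI)
      fix i j assume "i < dim_row (bloch u v z')" "j < dim_col (bloch u v z')"
      then have ij: "i < d" "j < d" using o by (auto simp: bloch_def plane_mat_def)
      have wi: "w $ k = C * u $ k + S * v $ k" if "k < d" for k
        using that o by (simp add: w_def C_def S_def)
      have cC: "cnj C = C" "cnj S = S" by (simp_all add: C_def S_def)
      \<comment> \<open>With entries named by atoms, \<alpha>^2 expressed through \<beta>^2 and
        \<open>S * S\<close> eliminated, the entrywise claim is an identity of polynomials.\<close>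
      define U V U' V' where "U = u $ i" and "V = v $ i" and "U' = cnj (u $ j)" and "V' = cnj (v $ j)"
      have SS: "S * S = 1 - C * C" using CS by (metis add_diff_cancel_left')
      then have cs2: "1 + C * C - S * S = 2 * (C * C)" by simp
      have "(C * U + S * V) * (C * U' + S * V') = C * C * (U * U') + C * S * (U * V' + V * U') + S * S * (V * V')"
        by (simp add: algebra_simps)
      then have ww': "(C * U + S * V) * (C * U' + S * V') =
          C * C * (U * U') + C * S * (U * V' + V * U') + (1 - C * C) * (V * V')"
        unfolding SS .
      have "F (bloch u v z) $$ (i, j) =
         (1 + p) / 2 * ((1 - 2 * B) * (U * U') + B * (U * U' + (C * U + S * V) * (C * U' + S * V'))
            + \<gamma> * (C * (U * (C * U' + S * V') - C * U * U') + C * ((C * U + S * V) * U' - C * U * U'))) +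
         q / 2 * ((1 - 2 * B) * (U * V') + \<gamma> * (C * (- C * U * V') + C * ((C * U + S * V) * V' - S * U * U'))) +
         q / 2 * ((1 - 2 * B) * (V * U') + \<gamma> * (C * (V * (C * U' + S * V') - S * U * U') + C * (- C * V * U'))) +
         (1 - p) / 2 * ((1 - 2 * B) * (V * V') + B * (U * U' + (C * U + S * V) * (C * U' + S * V'))
            + \<gamma> * (C * (- S * U * V') + C * (- S * V * U')))"
        unfolding Fb using FH ij o uw wu
        by (simp add: wi[OF ij(1)] wi[OF ij(2)] \<alpha>\<beta> U_def V_def U'_def V'_def B_def[symmetric] \<gamma>_def
            C_def[symmetric] S_def[symmetric] cC algebra_simps)
      also have "\<dots> = (1 + complex_of_real (Re z')) / 2 * (U * U') + complex_of_real (Im z') / 2 * (U * V') +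
        complex_of_real (Im z') / 2 * (V * U') + (1 - complex_of_real (Re z')) / 2 * (V * V')"
        unfolding rz ww' cs2 by (simp add: field_simps)
      also have "\<dots> = bloch u v z' $$ (i, j)"
        using ij o by (simp add: bloch_def plane_mat_def U_def V_def U'_def V'_def)
      finally show "F (bloch u v z) $$ (i, j) = bloch u v z' $$ (i, j)" .
    qed (use F_carrier[OF bloch_carrier[OF o(1)]] bloch_carrier[OF o(1)] in \<open>metis carrier_matD\<close>)+
    then show "apply_channel ?D d Ks
         (kron_mat (bloch u v z) (proj (kron_vec u (complex_of_real c \<cdot>\<^sub>v u + complex_of_real s \<cdot>\<^sub>v v)))) =
       bloch u v (Complex (2 * \<alpha>\<^sup>2) (2 * \<alpha> * \<beta> * c * s) * z + \<beta>\<^sup>2 * (1 + (Complex c s)\<^sup>2))"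
      by (simp add: F_def R_def w_def z'_def)
  qed
qed

section \<open>Accumulated error\<close>

text \<open>Each step adds at most the distance of the linear coefficient from
  \<open>cis (b * \<sigma>)\<close>, bounded by 7 b^2, and the translation \<nu>, bounded by 4 b^2;
  this gives 11.\<close>

lemma rotation_error:
  fixes a b \<sigma> :: real and \<nu> :: complex
  assumes b: "\<bar>b\<bar> \<le> 1 / 2" and \<sigma>: "\<bar>\<sigma>\<bar> \<le> 1" and \<nu>: "cmod \<nu> \<le> 4 * b\<^sup>2" and a: "a = sqrt (1 - 4 * b\<^sup>2)"
  shows "cmod (((\<lambda>z. Complex (a\<^sup>2) (a * b * \<sigma>) * z + \<nu>) ^^ n) 1 - cis (real n * (b * \<sigma>))) \<le> real n * (11 * b\<^sup>2)"
proof -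
  define \<mu> where "\<mu> = Complex (a\<^sup>2) (a * b * \<sigma>)"
  define \<eta> where "\<eta> = b * \<sigma>"
  have b2: "4 * b\<^sup>2 \<le> 1" using power_mono[OF b, of 2] by (simp add: power_divide)
  have a2: "a\<^sup>2 = 1 - 4 * b\<^sup>2" using b2 by (simp add: a)
  have a01: "0 \<le> a" "a \<le> 1" using b2 by (simp_all add: a)
  have \<sigma>2: "\<sigma>\<^sup>2 \<le> 1" using \<sigma> by (simp add: abs_square_le_1)
  have \<eta>2: "\<eta>\<^sup>2 \<le> b\<^sup>2" using mult_left_mono[OF \<sigma>2, of "b\<^sup>2"] by (simp add: \<eta>_def power_mult_distrib)
  have \<eta>4: "\<eta>\<^sup>2 \<le> 4 * b\<^sup>2" by (rule order_trans[OF \<eta>2]) simp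
  \<comment> \<open>The contraction: a^2 = 1 - 4 b^2 loses at least as much as \<eta>^2
    adds.\<close>
  have "(cmod \<mu>)\<^sup>2 = a\<^sup>2 * (a\<^sup>2 + \<eta>\<^sup>2)"
    unfolding cmod_power2 by (simp add: \<mu>_def \<eta>_def power2_eq_square algebra_simps)
  also have "\<dots> \<le> 1 * 1"
    using b2 \<eta>4 by (intro mult_mono) (simp_all add: a2)
  finally have \<mu>1: "cmod \<mu> \<le> 1" by (simp add: abs_square_le_1)
  have sin2: "(sin (\<eta> / 2))\<^sup>2 \<le> (\<eta> / 2)\<^sup>2"
    using abs_sin_x_le_abs_x by (simp only: abs_le_square_iff[symmetric])
  have cos_eq: "cos \<eta> = 1 - 2 * (sin (\<eta> / 2))\<^sup>2"
    using cos_double_sin[of "\<eta> / 2"] by simp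
  have "0 \<le> 1 - cos \<eta>" "1 - cos \<eta> \<le> b\<^sup>2 / 2"
    using sin2 cos_eq \<eta>2 by (auto simp: power_divide)
  then have re: "\<bar>a\<^sup>2 - cos \<eta>\<bar> \<le> 4 * b\<^sup>2" using a2 zero_le_power2[of b] by linarith
  have "(1 - a) * (1 + a) = 4 * b\<^sup>2" using a2 by (simp add: power2_eq_square algebra_simps)
  moreover have "(1 - a) * 1 \<le> (1 - a) * (1 + a)" using a01 by (intro mult_left_mono) auto
  ultimately have a1: "\<bar>a - 1\<bar> \<le> 4 * b\<^sup>2" using a01 by simp
  have \<eta>b: "\<bar>\<eta>\<bar> \<le> 1 / 2"
    using mult_mono[OF b \<sigma>] by (simp add: \<eta>_def abs_mult)
  have "\<bar>(a - 1) * \<eta>\<bar> \<le> 4 * b\<^sup>2 * (1 / 2)"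
    unfolding abs_mult using a1 \<eta>b by (intro mult_mono) auto
  \<comment> \<open>A remainder of second order suffices, since the other errors are quadratic in b
    too. Together with 2 b^2 from the previous bound this stays below 3 b^2.\<close>
  moreover have "\<bar>sin \<eta> - \<eta>\<bar> \<le> \<eta>\<^sup>2 / 2"
    using Maclaurin_sin_bound[of \<eta> 2] by (simp add: numeral_2_eq_2 sin_coeff_def power2_eq_square)
  moreover have "a * b * \<sigma> - sin \<eta> = (a - 1) * \<eta> - (sin \<eta> - \<eta>)" by (simp add: \<eta>_def algebra_simps)
  ultimately have im: "\<bar>a * b * \<sigma> - sin \<eta>\<bar> \<le> 3 * b\<^sup>2" using \<eta>2 by linarith
  have "cmod (\<mu> - cis \<eta>) \<le> \<bar>Re (\<mu> - cis \<eta>)\<bar> + \<bar>Im (\<mu> - cis \<eta>)\<bar>" by (rule cmod_le)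
  also have "\<dots> \<le> 7 * b\<^sup>2" using re im by (simp add: \<mu>_def)
  finally have \<mu>\<eta>: "cmod (\<mu> - cis \<eta>) \<le> 7 * b\<^sup>2" .
  have "cmod (((\<lambda>z. \<mu> * z + \<nu>) ^^ n) 1 - cis (real n * \<eta>)) \<le> real n * (11 * b\<^sup>2)"
  proof (induction n)
    case (Suc n)
    define z where "z = ((\<lambda>z. \<mu> * z + \<nu>) ^^ n) 1"
    define y where "y = cis (real n * \<eta>)"
    have "cis (real (Suc n) * \<eta>) = cis \<eta> * y"
      by (simp add: y_def cis_mult algebra_simps)
    then have "((\<lambda>z. \<mu> * z + \<nu>) ^^ Suc n) 1 - cis (real (Suc n) * \<eta>) = \<mu> * (z - y) + ((\<mu> - cis \<eta>) * y + \<nu>)"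
      by (simp add: z_def algebra_simps)
    also have "cmod \<dots> \<le> cmod (\<mu> * (z - y)) + (cmod ((\<mu> - cis \<eta>) * y) + cmod \<nu>)"
      by (meson add_left_mono norm_triangle_ineq order_trans)
    also have "\<dots> = cmod \<mu> * cmod (z - y) + (cmod (\<mu> - cis \<eta>) + cmod \<nu>)"
      by (simp add: norm_mult y_def)
    also have "\<dots> \<le> 1 * (real n * (11 * b\<^sup>2)) + (7 * b\<^sup>2 + 4 * b\<^sup>2)"
      using Suc.IH \<mu>1 \<mu>\<eta> \<nu> by (intro add_mono mult_mono) (auto simp: z_def y_def)
    also have "\<dots> = real (Suc n) * (11 * b\<^sup>2)" by (simp add: algebra_simps)
    finally show ?case .
  qed simp
  then show ?thesis by (simp add: \<mu>_def \<eta>_def)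
qed

section \<open>The plane spanned by the two states\<close>

text \<open>Cauchy-Schwarz for unit vectors, by the arithmetic-geometric mean inequality in each
  coordinate. It places the overlap in the range where \<open>cos\<close> inverts
  \<open>arccos\<close>.\<close>

lemma cmod_cinner_le_1:
  assumes "unit_state d u" "unit_state d v"
  shows "cmod (cinner u v) \<le> 1"
proof -
  have u: "u \<in> carrier_vec d" "(\<Sum>i<d. (cmod (u $ i))\<^sup>2) = 1"
    and v: "v \<in> carrier_vec d" "(\<Sum>i<d. (cmod (v $ i))\<^sup>2) = 1"
    using assms cinner_self[of u d] cinner_self[of v d] unfolding unit_state_def
    by (metis of_real_eq_1_iff)+
  have "cmod (cinner u v) \<le> (\<Sum>i<d. cmod (u $ i) * cmod (v $ i))"
    using v(1) by (simp add: cinner_eq_sum) (rule order_trans[OF norm_sum], simp add: norm_mult)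
  also have "\<dots> \<le> (\<Sum>i<d. ((cmod (u $ i))\<^sup>2 + (cmod (v $ i))\<^sup>2) / 2)"
    using sum_squares_bound[of "cmod (u $ _)" "cmod (v $ _)"] by (intro sum_mono) (simp add: field_simps)
  also have "\<dots> = 1" using u v by (simp add: sum.distrib sum_divide_distrib[symmetric])
  finally show ?thesis .
qed

lemma proj_smult: "cmod c = 1 \<Longrightarrow> proj (c \<cdot>\<^sub>v v) = proj v"
proof (rule eq_matI)
  assume "cmod c = 1"
  then have c: "c * cnj c = 1" by (simp add: complex_norm_square[symmetric])
  fix i j assume "i < dim_row (proj v)" "j < dim_col (proj v)"
  moreover have "c * x * (cnj c * y) = x * y" for x y :: complex
    using c by (metis mult.assoc mult.left_commute mult_1)
  ultimately show "proj (c \<cdot>\<^sub>v v) $$ (i, j) = proj v $$ (i, j)" by (simp add: proj_def)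
qed (simp_all add: proj_def)

text \<open>The phase in \<open>psi_chi\<close> is the \<open>f\<close> that makes the overlap of
  \<open>u\<close> with f v equal to cos \<Delta>, so after Gram-Schmidt the addition formula
  collapses \<open>psi_chi\<close> to cos \<chi> u + sin \<chi> e. The bound \<Delta> < pi / 2 makes
  \<open>f\<close> a unit scalar, and 0 < \<Delta> allows the division by sin \<Delta>.\<close>

lemma adapted_frame:
  assumes u: "unit_state d u" and v: "unit_state d v" and ar: "arccos (cmod (cinner u v)) = \<Delta>"
    and \<Delta>: "0 < \<Delta>" "\<Delta> < pi / 2"
  obtains e where "orthonormal_pair d u e"
    "proj (kron_vec u v) = proj (kron_vec u (complex_of_real (cos \<Delta>) \<cdot>\<^sub>v u + complex_of_real (sin \<Delta>) \<cdot>\<^sub>v e))"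
    "\<And>\<chi>. proj (psi_chi u v \<Delta> \<chi>) = bloch u e (cis (2 * \<chi>))"
proof -
  have uc: "u \<in> carrier_vec d" "cinner u u = 1" and vc: "v \<in> carrier_vec d" "cinner v v = 1"
    using u v by (auto simp: unit_state_def)
  define f where "f = cinner v u / complex_of_real (cmod (cinner v u))"
  define C where "C = complex_of_real (cos \<Delta>)"
  define S where "S = complex_of_real (sin \<Delta>)"
  have S0: "S \<noteq> 0" using sin_gt_zero[of \<Delta>] \<Delta> by (simp add: S_def)
  have CS: "C * C + S * S = 1"
    unfolding C_def S_def power2_eq_square[symmetric] of_real_power[symmetric] of_real_add[symmetric]
      sin_cos_squared_add2 by simp
  have cosD: "cmod (cinner u v) = cos \<Delta>"
    using cmod_cinner_le_1[OF u v] cos_arccos[of "cmod (cinner u v)"] ar norm_ge_zero[of "cinner u v"] by simp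
  have uv: "cinner v u = cnj (cinner u v)" using cinner_commute[OF vc(1) uc(1)] .
  have cpos: "0 < cos \<Delta>" using \<Delta> by (intro cos_gt_zero_pi) auto
  have f: "cmod f = 1" using cosD cpos by (simp add: f_def uv norm_divide)
  define w where "w = f \<cdot>\<^sub>v v"
  have w: "w \<in> carrier_vec d" using vc by (simp add: w_def)
  have "f * cinner u v = C"
    using cosD cpos complex_norm_square[of "cinner u v"]
    by (simp add: f_def uv C_def power2_eq_square mult.commute divide_eq_eq)
  then have uw: "cinner u w = C" by (simp add: w_def cinner_smult_right)
  have wu: "cinner w u = C" using cinner_commute[OF w uc(1)] uw by (simp add: C_def)
  have ww: "cinner w w = 1"
    using f vc complex_norm_square[of f] by (simp add: w_def cinner_smult_right cinner_smult_left[of _ d])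
  define e where "e = (1 / S) \<cdot>\<^sub>v (w + (- C) \<cdot>\<^sub>v u)"
  have e: "e \<in> carrier_vec d" using w uc by (simp add: e_def)
  have we: "w = C \<cdot>\<^sub>v u + S \<cdot>\<^sub>v e"
    using S0 w uc by (intro eq_vecI) (auto simp: e_def)
  have ue: "cinner u e = 0"
    using uw uc w by (simp add: e_def cinner_smult_right cinner_add_right[of _ d])
  have eu: "cinner e u = 0" using cinner_commute[OF e uc(1)] ue by simp
  have "cinner w e = S"
    using S0 ww wu w uc CS
    by (simp add: e_def cinner_smult_right cinner_add_right[of _ d] divide_eq_eq algebra_simps)
  then have "cinner e w = S" using cinner_commute[OF e w] by (simp add: S_def)
  then have "S * cinner e e = S"
    using eu uc e by (simp add: we cinner_smult_right cinner_add_right[of _ d])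
  then have ee: "cinner e e = 1" using S0 by simp
  show thesis
  proof
    show "orthonormal_pair d u e"
      using uc e ee ue by (simp add: orthonormal_pair_def unit_state_def)
    have "proj (kron_vec u v) = proj (f \<cdot>\<^sub>v kron_vec u v)" using proj_smult[OF f] by simp
    then show "proj (kron_vec u v) = proj (kron_vec u (complex_of_real (cos \<Delta>) \<cdot>\<^sub>v u + complex_of_real (sin \<Delta>) \<cdot>\<^sub>v e))"
      using we by (simp add: kron_vec_smult_right[symmetric] w_def C_def S_def)
    fix \<chi>
    have "psi_chi u v \<Delta> \<chi> = complex_of_real (cos \<chi>) \<cdot>\<^sub>v u + complex_of_real (sin \<chi>) \<cdot>\<^sub>v e"
    proof (rule eq_vecI)
      fix i assume "i < dim_vec (complex_of_real (cos \<chi>) \<cdot>\<^sub>v u + complex_of_real (sin \<chi>) \<cdot>\<^sub>v e)"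
      then have i: "i < d" using uc e by simp
      have fv: "f * v $ i = C * u $ i + S * e $ i"
        using arg_cong[OF we, of "\<lambda>x. x $ i"] i vc uc e by (simp add: w_def)
      have "S * psi_chi u v \<Delta> \<chi> $ i = complex_of_real (sin (\<Delta> - \<chi>)) * u $ i +
          complex_of_real (sin \<chi>) * (f * v $ i)"
        using i uc vc S0 by (simp add: psi_chi_def f_def[symmetric] S_def algebra_simps)
      also have "\<dots> = S * (complex_of_real (cos \<chi>) * u $ i + complex_of_real (sin \<chi>) * e $ i)"
        unfolding fv by (simp add: sin_diff C_def S_def algebra_simps)
      finally show "psi_chi u v \<Delta> \<chi> $ i = (complex_of_real (cos \<chi>) \<cdot>\<^sub>v u + complex_of_real (sin \<chi>) \<cdot>\<^sub>v e) $ i"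
        using S0 i uc e by simp
    qed (use uc vc e in \<open>simp add: psi_chi_def Let_def\<close>)
    moreover have "bloch u e (cis (2 * \<chi>)) = plane_mat u e
        ((cos \<chi>)\<^sup>2) (sin \<chi> * cos \<chi>) (sin \<chi> * cos \<chi>) ((sin \<chi>)\<^sup>2)"
    proof -
      have "(1 + cos (2 * \<chi>)) / 2 = (cos \<chi>)\<^sup>2" by (simp add: cos_double_cos)
      moreover have "(1 - cos (2 * \<chi>)) / 2 = (sin \<chi>)\<^sup>2" by (simp add: cos_double_sin)
      moreover have "sin (2 * \<chi>) / 2 = sin \<chi> * cos \<chi>" by (simp add: sin_double)
      ultimately show ?thesis unfolding bloch_def cis.sel by (simp only:)
    qed
    ultimately show "proj (psi_chi u v \<Delta> \<chi>) = bloch u e (cis (2 * \<chi>))"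
      using uc e by (intro eq_matI) (auto simp: proj_def plane_mat_def power2_eq_square algebra_simps)
  qed
qed

text \<open>With \<open>bloch u e\<close> for \<open>g\<close>, this moves the iteration from
  matrices to the affine map on complex numbers.\<close>

lemma funpow_semiconj: "(\<And>z. F (g z) = g (f z)) \<Longrightarrow> (F ^^ n) (g z) = g ((f ^^ n) z)"
  by (induction n) auto

text \<open>The order of the quantifiers expresses that the states are unknown. The
  \<open>max 1\<close> is the reading of O for small arguments: at \<chi> = 0 the quotient vanishes,
  yet an output made from no copies could not follow the first state.\<close>

theorem mainTheorem13:
  "\<exists>C>0. \<forall>(d::nat) (\<Delta>::real) (\<chi>::real) (\<delta>::real).
     d > 0 \<and> 0 < \<Delta> \<and> \<Delta> < pi / 2 \<and> 0 < \<delta> \<longrightarrow>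
     (\<exists>(m::nat) Ks.
        real m \<le> C * max 1 (\<chi>\<^sup>2 / (\<delta> * (sin (2 * \<Delta>))\<^sup>2)) \<and>
        kraus_channel (d ^ m * d ^ m) d Ks \<and>
        (\<forall>\<psi>1 \<psi>2. unit_state d \<psi>1 \<and> unit_state d \<psi>2 \<and>
            arccos (cmod (cinner \<psi>1 \<psi>2)) = \<Delta> \<longrightarrow>
            trace_dist
              (apply_channel (d ^ m * d ^ m) d Ks
                 (proj (kron_vec (tpow m \<psi>1) (tpow m \<psi>2))))
              (proj (psi_chi \<psi>1 \<psi>2 \<Delta> \<chi>)) \<le> \<delta>))"
proof (rule exI[of _ 26], intro conjI allI impI)
  fix d :: nat and \<Delta> \<chi> \<delta> :: real
  assume "d > 0 \<and> 0 < \<Delta> \<and> \<Delta> < pi / 2 \<and> 0 < \<delta>"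
  then have \<Delta>: "0 < \<Delta>" "\<Delta> < pi / 2" and \<delta>: "0 < \<delta>" by auto
  define \<sigma> where "\<sigma> = sin (2 * \<Delta>)"
  have \<sigma>: "0 < \<sigma>" "\<bar>\<sigma>\<bar> \<le> 1" using sin_gt_zero[of "2 * \<Delta>"] \<Delta> by (auto simp: \<sigma>_def)
  define Y where "Y = \<chi>\<^sup>2 / (\<delta> * \<sigma>\<^sup>2)"
  have Y0: "0 \<le> Y" using \<delta> by (simp add: Y_def)
  \<comment> \<open>For large \<delta> the bound on n would not make the step b small, but then u itself is good enough.\<close>
  define n where "n = (if \<delta> \<ge> 1 then 0 else nat \<lceil>24 * Y\<rceil>)"
  \<comment> \<open>One step turns the Bloch vector by about \<open>b * \<sigma>\<close>, and the
    target angle is 2 \<chi>. For \<open>n = 0\<close> division by zero gives \<open>b = 0\<close>;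
    with \<delta> < 1 this occurs only for \<chi> = 0, where the angle is still right.\<close>
  define b where "b = 2 * \<chi> / (real n * \<sigma>)"
  define a where "a = sqrt (1 - 4 * b\<^sup>2)"
  have n_le: "real n \<le> 24 * Y + 1" using Y0 by (auto simp: n_def)
  have small: "\<bar>b\<bar> \<le> 1 / 2 \<and> (\<delta> < 1 \<longrightarrow> real n * (b * \<sigma>) = 2 * \<chi> \<and> real n * (11 * b\<^sup>2) \<le> 2 * \<delta>)"
  proof (cases "n = 0")
    case True
    have "\<chi> = 0" if "\<delta> < 1"
    proof -
      have "24 * Y \<le> 0" using True that by (simp add: n_def)
      then have "Y = 0" using Y0 by simp
      then show ?thesis using \<delta> \<sigma> by (simp add: Y_def)
    qed
    then show ?thesis using True \<delta> by (auto simp: b_def)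
  next
    case False
    then have \<delta>1: "\<delta> < 1" and nY: "24 * Y \<le> real n" by (auto simp: n_def split: if_splits)
    have n1: "1 \<le> real n" using False by simp
    \<comment> \<open>The 24 in \<open>n\<close> is 4 times 6: it yields n b^2 \<le> \<delta> / 6,
      hence an accumulated error of at most 11 \<delta> / 6, and with \<delta> < 1 also b^2 \<le> 1
      / 4.\<close>
    have nb: "real n * b\<^sup>2 = 4 * (\<delta> * Y) / real n"
      using False \<sigma> \<delta> by (simp add: b_def Y_def field_simps power2_eq_square)
    also have "\<dots> \<le> \<delta> / 6"
      using mult_left_mono[OF nY, of \<delta>] \<delta> n1 by (simp add: field_simps)
    finally have nb: "real n * b\<^sup>2 \<le> \<delta> / 6" .
    moreover have "1 * b\<^sup>2 \<le> real n * b\<^sup>2" using n1 by (intro mult_right_mono) auto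
    ultimately have "b\<^sup>2 \<le> (1 / 2)\<^sup>2" using \<delta>1 by (simp add: power_divide)
    then have "\<bar>b\<bar> \<le> 1 / 2" using abs_le_square_iff[of b "1 / 2"] by simp
    moreover have "real n * (b * \<sigma>) = 2 * \<chi>" using False \<sigma> by (simp add: b_def)
    ultimately show ?thesis using nb \<delta> by (simp add: algebra_simps)
  qed
  have b2: "4 * b\<^sup>2 \<le> 1" using power_mono[of "\<bar>b\<bar>" "1 / 2" 2] small by (simp add: power_divide)
  \<comment> \<open>Scaled so that the Bloch map has coefficients a^2 and a b \<sigma>; the
    constraint \<alpha>^2 + \<beta>^2 = 1 / 2 then becomes a^2 = 1 - 4 b^2.\<close>
  define \<alpha> \<beta> where "\<alpha> = a / sqrt 2" and "\<beta> = sqrt 2 * b"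
  have \<alpha>\<beta>: "2 * \<alpha>\<^sup>2 = a\<^sup>2" "\<alpha> * \<beta> = a * b" "\<beta>\<^sup>2 = 2 * b\<^sup>2"
    by (simp_all add: \<alpha>_def \<beta>_def power_divide power_mult_distrib)
  have "\<alpha>\<^sup>2 + \<beta>\<^sup>2 = 1 / 2" using \<alpha>\<beta> b2 by (simp add: a_def)
  from step_bloch[OF this, of d] obtain Ss where Ss: "kraus_channel (d * (d * d)) d Ss"
    "\<And>u v c s z. orthonormal_pair d u v \<Longrightarrow> c\<^sup>2 + s\<^sup>2 = 1 \<Longrightarrow>
       apply_channel (d * (d * d)) d Ss
         (kron_mat (bloch u v z) (proj (kron_vec u (complex_of_real c \<cdot>\<^sub>v u + complex_of_real s \<cdot>\<^sub>v v)))) =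
       bloch u v (Complex (2 * \<alpha>\<^sup>2) (2 * \<alpha> * \<beta> * c * s) * z + \<beta>\<^sup>2 * (1 + (Complex c s)\<^sup>2))"
    by blast
  define F where "F u v \<tau> = apply_channel (d * (d * d)) d Ss (kron_mat \<tau> (proj (kron_vec u v)))" for u v \<tau>
  obtain Ks where Ks: "kraus_channel (d ^ Suc n * d ^ Suc n) d Ks"
    "\<And>u v. unit_state d u \<Longrightarrow> unit_state d v \<Longrightarrow>
       apply_channel (d ^ Suc n * d ^ Suc n) d Ks (proj (kron_vec (tpow (Suc n) u) (tpow (Suc n) v))) =
       (F u v ^^ n) (proj u)"
    using simulation_channel[OF Ss(1), of n] unfolding F_def by blast
  define \<nu> where "\<nu> = complex_of_real (\<beta>\<^sup>2) * (1 + (Complex (cos \<Delta>) (sin \<Delta>))\<^sup>2)"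
  define f where "f z = Complex (a\<^sup>2) (a * b * \<sigma>) * z + \<nu>" for z
  have "cmod (1 + (cis \<Delta>)\<^sup>2) \<le> 1 + 1"
    using norm_triangle_ineq[of 1 "(cis \<Delta>)\<^sup>2"] by (simp add: norm_power)
  then have \<nu>_le: "cmod \<nu> \<le> 4 * b\<^sup>2"
    using mult_left_mono[of "cmod (1 + (cis \<Delta>)\<^sup>2)" 2 "2 * b\<^sup>2"]
    by (simp add: \<nu>_def \<alpha>\<beta> norm_mult norm_power cis.code[symmetric])
  \<comment> \<open>Trace distance is half the Bloch distance, which permits 2 \<delta>. For
    \<delta> \<ge> 1 no step is made, and two points of the unit circle are at most 2 apart.\<close>
  have fn: "cmod ((f ^^ n) 1 - cis (2 * \<chi>)) \<le> 2 * \<delta>"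
  proof (cases "\<delta> < 1")
    case True
    then show ?thesis
      using rotation_error[of b \<sigma> \<nu> a n] small \<sigma> \<nu>_le a_def unfolding f_def[abs_def] by fastforce
  next
    case False
    then have "cmod ((f ^^ n) 1 - cis (2 * \<chi>)) \<le> 1 + 1"
      using norm_triangle_ineq4[of 1 "cis (2 * \<chi>)"] by (simp add: n_def)
    then show ?thesis using False by simp
  qed
  have "trace_dist (apply_channel (d ^ Suc n * d ^ Suc n) d Ks (proj (kron_vec (tpow (Suc n) u) (tpow (Suc n) v))))
      (proj (psi_chi u v \<Delta> \<chi>)) \<le> \<delta>"
    if u: "unit_state d u" and v: "unit_state d v" and ar: "arccos (cmod (cinner u v)) = \<Delta>" for u v
  proof -
    obtain e where e: "orthonormal_pair d u e"
      "proj (kron_vec u v) = proj (kron_vec u (complex_of_real (cos \<Delta>) \<cdot>\<^sub>v u + complex_of_real (sin \<Delta>) \<cdot>\<^sub>v e))"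
      "\<And>\<chi>. proj (psi_chi u v \<Delta> \<chi>) = bloch u e (cis (2 * \<chi>))"
      using adapted_frame[OF u v ar \<Delta>] by blast
    have "2 * \<alpha> * \<beta> * cos \<Delta> * sin \<Delta> = \<alpha> * \<beta> * (2 * sin \<Delta> * cos \<Delta>)" by simp
    then have coeff: "2 * \<alpha> * \<beta> * cos \<Delta> * sin \<Delta> = a * b * \<sigma>"
      unfolding \<alpha>\<beta>(2) \<sigma>_def sin_double .
    have "F u v (bloch u e z) = bloch u e (f z)" for z
      unfolding F_def e(2) f_def \<nu>_def
      by (subst Ss(2)[OF e(1)]) (simp_all add: \<alpha>\<beta> coeff)
    then have "(F u v ^^ n) (bloch u e 1) = bloch u e ((f ^^ n) 1)"
      by (rule funpow_semiconj)
    moreover have "proj u = bloch u e 1"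
      using orthonormal_pairD(1)[OF e(1)] by (intro eq_matI) (auto simp: proj_def bloch_def plane_mat_def)
    ultimately show ?thesis
      using fn unfolding Ks(2)[OF u v] e(3) by (simp add: trace_dist_bloch[OF e(1)])
  qed
  \<comment> \<open>24 Y from the steps, 1 from rounding up and 1 for the pair that supplies the
    starting state.\<close>
  moreover have "real (Suc n) \<le> 26 * max 1 (\<chi>\<^sup>2 / (\<delta> * (sin (2 * \<Delta>))\<^sup>2))"
    using n_le unfolding Y_def \<sigma>_def by simp
  ultimately show "\<exists>m Ks. real m \<le> 26 * max 1 (\<chi>\<^sup>2 / (\<delta> * (sin (2 * \<Delta>))\<^sup>2)) \<and>
        kraus_channel (d ^ m * d ^ m) d Ks \<and>
        (\<forall>\<psi>1 \<psi>2. unit_state d \<psi>1 \<and> unit_state d \<psi>2 \<and> arccos (cmod (cinner \<psi>1 \<psi>2)) = \<Delta> \<longrightarrow>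
            trace_dist (apply_channel (d ^ m * d ^ m) d Ks (proj (kron_vec (tpow m \<psi>1) (tpow m \<psi>2))))
              (proj (psi_chi \<psi>1 \<psi>2 \<Delta> \<chi>)) \<le> \<delta>)"
    using Ks(1) by (intro exI[of _ "Suc n"] exI[of _ Ks]) blast
qed simp

end
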